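(* The set $A$ is uncountable and is naturally indexed by $$\mathcal{K}=\{k=k_0k_1k_2\dots : k_i\in\mathbb{N},\ k_{2i}\ne1 \text{ for infinitely many } i,\ \text{and } k_{2i+1}\neq 1\text{ for infinitely many } i\},$$ that is, the coding map $(\alpha,\beta)\mapsto (k_n)_{n\ge0}$, where $k_n=j$ if $G^n(\alpha,\beta)\in\mathcal{U}_j$, is a bijection from $A$ onto $\mathcal{K}$. For any sequence $k\in\mathcal{K}$, with corresponding parameter $(\alpha,\beta)\in A$, the map $T_{\alpha,\beta}|_{\overline{\Omega}}$ is isomorphic to the shift space $(\Sigma_{\alpha,\beta},\sigma)$ generated by the chain of substitutions $\chi_{k_0}\circ\chi_{k_1}\circ\chi_{k_2}\circ\cdots$, where $$\chi_k:\quad 1\mapsto 2,\qquad 2\mapsto 31^k,\qquad 3\mapsto 31^{k-1}.$$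
   Context: $\mathbb{N}=\{1,2,3,\dots\}$. Let $U=\{(\alpha,\beta):0\le\beta\le\alpha\le1\}$ with interior $U^\circ$, $L=\{(\alpha,\beta):0\le\alpha\le\beta+1\le1\}$, $R=U\cup L$. For $(\alpha,\beta)\in U^\circ$ define $T=T_{\alpha,\beta}:[0,1)\to[0,1)$ by $T(x)=x+\alpha$ on $B_1=[0,1-\alpha)$, $T(x)=x+\beta$ on $B_2=[1-\alpha,1-\beta)$, and $T(x)=x+\beta-1$ on $B_3=[1-\beta,1)$. Put $\Omega_0=[0,1)$, $\Omega_n=T(\Omega_{n-1})$, $\Omega=\bigcap_n\Omega_n$; on $\overline\Omega\setminus\Omega$ the map $T$ is (re)defined by continuity from the left. The Gauss map $G:U^\circ\to R$ is $G(\alpha,\beta)=\big(\frac\beta\alpha,\frac{\beta-1}{\alpha}+\lfloor\frac1\alpha\rfloor\big)$; $A=\bigcap_{n\ge0}G^{-n}(U^\circ)$ is the set of points all of whose $G$-iterates are defined and lie in $U^\circ$; and $\mathcal{U}_k=\{(\alpha,\beta)\in U:\frac1{k+1}<\alpha\le\frac1k\}$ for $k\in\mathbb{N}$. Substitutions act on words over $\{1,2,3\}$ by concatenation; $1^k$ denotes $k$ repetitions of the symbol $1$. For $k\in\mathcal{K}$ let $s=\lim_{i\to\infty}\chi_{k_0}\circ\dots\circ\chi_{k_i}(3)\in\{1,2,3\}^{\mathbb{N}\cup\{0\}}$ (the words on the right are prefixes of one another with lengths tending to infinity), and let $\Sigma_{\alpha,\beta}=\overline{\{\sigma^i(s):i\ge0\}}$,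 where $\sigma$ is the left shift. "Isomorphic" is understood in the sense of symbolic coding: the itinerary coding ($x\mapsto (e_n)$ with $e_n=j$ iff $T^n(x)\in B_j$) gives a map $h:\overline\Omega\to\Sigma_{\alpha,\beta}$, intertwining $T$ and $\sigma$, which is continuous and one-to-one except possibly at the countable set $\bigcup_i T^{-i}(\{1-\alpha,1-\beta\})$. *)

theory Defs
  imports "HOL-Analysis.Analysis"
begin

text \<open>A parameter \<open>(\<alpha>, \<beta>)\<close> is a pair of reals, written \<open>p\<close> when it need not be taken apart.\<close>

definition U :: "(real \<times> real) set" where
  "U = {(\<alpha>, \<beta>). 0 \<le> \<beta> \<and> \<beta> \<le> \<alpha> \<and> \<alpha> \<le> 1}"

definition B1 :: "real \<times> real \<Rightarrow> real set" where
  "B1 = (\<lambda>(\<alpha>, \<beta>). {0..<1 - \<alpha>})"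

definition B2 :: "real \<times> real \<Rightarrow> real set" where
  "B2 = (\<lambda>(\<alpha>, \<beta>). {1 - \<alpha>..<1 - \<beta>})"

definition B3 :: "real \<times> real \<Rightarrow> real set" where
  "B3 = (\<lambda>(\<alpha>, \<beta>). {1 - \<beta>..<1})"

text \<open>The interval translation map. Only its values on \<open>[0,1)\<close>, the union of the three branch
  domains, are meaningful.\<close>

definition T :: "real \<times> real \<Rightarrow> real \<Rightarrow> real" where
  "T = (\<lambda>(\<alpha>, \<beta>) x. if x \<in> B1 (\<alpha>, \<beta>) then x + \<alpha>
          else if x \<in> B2 (\<alpha>, \<beta>) then x + \<beta>
          else x + \<beta> - 1)"

definition Omega_n :: "real \<times> real \<Rightarrow> nat \<Rightarrow> real set" where
  "Omega_n p n = ((\<lambda>X. T p ` X) ^^ n) {0..<1}"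

definition Omega :: "real \<times> real \<Rightarrow> real set" where
  "Omega p = (\<Inter>n. Omega_n p n)"

text \<open>The map \<open>T\<close> on the closure of \<open>\<Omega>\<close>: on the added points it takes the left limit
  of \<open>T\<close>. In particular its value at the point 1 is \<open>\<beta>\<close>.\<close>

definition Tbar :: "real \<times> real \<Rightarrow> real \<Rightarrow> real" where
  "Tbar p x = (if x \<in> closure (Omega p) - Omega p then Lim (at_left x) (T p) else T p x)"

text \<open>The letter \<open>j\<close> of the branch domain \<open>B\<^sub>j\<close> containing \<open>x\<close>. The domains cover only
  \<open>[0,1)\<close>; the point 1, which can lie in the closure of \<open>\<Omega>\<close>, gets the letter 3, in accordance
  with continuity from the left.\<close>

definition letter :: "real \<times> real \<Rightarrow> real \<Rightarrow> nat" where
  "letter p x = (if x \<in> B1 p then 1 else if x \<in> B2 p then 2 else 3)"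

definition itinerary :: "real \<times> real \<Rightarrow> real \<Rightarrow> nat \<Rightarrow> nat" where
  "itinerary p x = (\<lambda>n. letter p ((Tbar p ^^ n) x))"

definition exceptional :: "real \<times> real \<Rightarrow> real set" where
  "exceptional = (\<lambda>(\<alpha>, \<beta>).
     {x \<in> closure (Omega (\<alpha>, \<beta>)). \<exists>i. (Tbar (\<alpha>, \<beta>) ^^ i) x \<in> {1 - \<alpha>, 1 - \<beta>}})"

definition G :: "real \<times> real \<Rightarrow> real \<times> real" where
  "G = (\<lambda>(\<alpha>, \<beta>). (\<beta> / \<alpha>, (\<beta> - 1) / \<alpha> + of_int \<lfloor>1 / \<alpha>\<rfloor>))"

definition A :: "(real \<times> real) set" where
  "A = {p. \<forall>n. (G ^^ n) p \<in> interior U}"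

definition U_strip :: "nat \<Rightarrow> (real \<times> real) set" where
  "U_strip k = {(\<alpha>, \<beta>). (\<alpha>, \<beta>) \<in> U \<and> 1 / (real k + 1) < \<alpha> \<and> \<alpha> \<le> 1 / real k}"

definition gauss_code :: "real \<times> real \<Rightarrow> nat \<Rightarrow> nat" where
  "gauss_code p = (\<lambda>n. THE j. 1 \<le> j \<and> (G ^^ n) p \<in> U_strip j)"

definition K :: "(nat \<Rightarrow> nat) set" where
  "K = {k. (\<forall>i. 1 \<le> k i) \<and> infinite {i. k (2 * i) \<noteq> 1} \<and> infinite {i. k (2 * i + 1) \<noteq> 1}}"

text \<open>Letters are the natural numbers 1, 2, 3; the last case below is meant for the letter 3.\<close>

definition chi :: "nat \<Rightarrow> nat \<Rightarrow> nat list" where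
  "chi k a = (if a = 1 then [2]
     else if a = 2 then 3 # replicate k 1
     else 3 # replicate (k - 1) 1)"

definition subst :: "nat \<Rightarrow> nat list \<Rightarrow> nat list" where
  "subst k w = concat (map (chi k) w)"

primrec chain :: "(nat \<Rightarrow> nat) \<Rightarrow> nat \<Rightarrow> nat list \<Rightarrow> nat list" where
  "chain k 0 = subst (k 0)"
| "chain k (Suc i) = chain k i \<circ> subst (k (Suc i))"

definition limit_word :: "(nat \<Rightarrow> nat list) \<Rightarrow> nat \<Rightarrow> nat" where
  "limit_word w = (\<lambda>n. THE a. \<forall>\<^sub>F i in sequentially. n < length (w i) \<and> w i ! n = a)"

definition shift :: "(nat \<Rightarrow> nat) \<Rightarrow> nat \<Rightarrow> nat" where
  "shift x = (\<lambda>n. x (Suc n))"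

text \<open>The closure is taken in the product topology on \<open>nat \<Rightarrow> nat\<close> with \<open>nat\<close> discrete, in which
  the sequences over \<open>{1, 2, 3}\<close> form a closed subset.\<close>

definition Sigma_shift :: "(nat \<Rightarrow> nat) \<Rightarrow> (nat \<Rightarrow> nat) set" where
  "Sigma_shift k = closure {(shift ^^ i) (limit_word (\<lambda>i. chain k i [3])) | i. True}"

text \<open>\<open>h\<close> codes the system \<open>f\<close> on \<open>X\<close> by the subshift \<open>S\<close>, up to a countable exceptional set \<open>D\<close>:
  at every point outside \<open>D\<close> it is continuous, as a map on \<open>X\<close>, and one-to-one. At a point of
  \<open>D\<close> the coding selects one of two one-sided itineraries, so \<open>h\<close> need not be onto \<open>S\<close>;
  its image is dense.\<close>

definition coding_isomorphism ::
  "(real \<Rightarrow> real) \<Rightarrow> real set \<Rightarrow> real set \<Rightarrow> (real \<Rightarrow> nat \<Rightarrow> nat) \<Rightarrow> (nat \<Rightarrow> nat) set \<Rightarrow> bool" where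
  "coding_isomorphism f X D h S \<longleftrightarrow>
     f ` X \<subseteq> X \<and>
     h ` X \<subseteq> S \<and>
     S \<subseteq> closure (h ` X) \<and>
     (\<forall>x\<in>X. h (f x) = shift (h x)) \<and>
     countable D \<and>
     (\<forall>x\<in>X - D. continuous (at x within X) h) \<and>
     (\<forall>x\<in>X - D. \<forall>y\<in>X. h y = h x \<longrightarrow> y = x)"

end

theory Submission
  imports Defs
begin

text \<open>Let \<open>\<alpha>\<^sub>n\<close> be the first coordinate of \<open>G\<^sup>n p\<close>. Then \<open>1 / \<alpha>\<^sub>n = k\<^sub>n + \<alpha>\<^sub>n\<^sub>+\<^sub>1 (1 - \<alpha>\<^sub>n\<^sub>+\<^sub>2)\<close>, so \<open>p\<close> is
  the value of a generalised continued fraction. If two parameters have the same code and the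
  ratios of their coordinates at levels \<open>n + 1\<close> and \<open>n + 2\<close> are at most \<open>1 + e\<close>, then the ratio at
  level \<open>n\<close> is at most \<open>1 + \<alpha>\<^sub>n \<alpha>\<^sub>n\<^sub>+\<^sub>1 e\<close>; this contraction shows that the code determines \<open>p\<close>.
  Existence is compactness of nested cylinders, and the condition defining \<open>K\<close> is what keeps the
  limit point off the edges \<open>\<alpha> = 1\<close> and \<open>\<alpha> = \<beta>\<close> of \<open>U\<close>, which the inverse branches with
  \<open>k = 1\<close> interchange.

  The first return map of \<open>T\<close> to \<open>[1 - \<alpha>, 1]\<close> is a rescaled copy of the map with parameter \<open>G p\<close>,
  with the words of \<open>\<chi>\<close> as excursions. Since 1 is fixed by the rescaling, the limit word is the
  itinerary of 1. A point of the closure of \<open>\<Omega>\<close> outside \<open>\<Omega>\<close> lies on the orbit of 1, and a point of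
  \<open>\<Omega>\<close> is approximated from the right by the orbit of 1; as itineraries are continuous from the
  right, both have itineraries in \<open>\<Sigma>\<close>. Two points with the same itinerary keep their distance
  forever, and renormalising magnifies this distance beyond all bounds.\<close>

section \<open>The Gauss map and its inverse branches\<close>

lemma interior_U: "interior U = {p. 0 < snd p \<and> snd p < fst p \<and> fst p < 1}"
proof
  show "interior U \<subseteq> {p. 0 < snd p \<and> snd p < fst p \<and> fst p < 1}"
  proof
    fix p assume "p \<in> interior U"
    then obtain e where e: "e > 0" "ball p e \<subseteq> U"
      by (auto simp: mem_interior)
    obtain a b where p: "p = (a, b)" by (cases p)
    have "(a + e/2, b) \<in> ball p e" "(a - e/2, b) \<in> ball p e" "(a, b - e/2) \<in> ball p e"
      using e(1) by (auto simp: p dist_prod_def dist_real_def)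
    then have "(a + e/2, b) \<in> U" "(a - e/2, b) \<in> U" "(a, b - e/2) \<in> U"
      using e(2) by blast+
    then show "p \<in> {p. 0 < snd p \<and> snd p < fst p \<and> fst p < 1}"
      using e(1) by (auto simp: U_def p)
  qed
  have "open {p::real \<times> real. 0 < snd p \<and> snd p < fst p \<and> fst p < 1}"
    by (intro open_Collect_conj open_Collect_less continuous_intros)
  then show "{p. 0 < snd p \<and> snd p < fst p \<and> fst p < 1} \<subseteq> interior U"
    by (intro interior_maximal) (auto simp: U_def)
qed

text \<open>The partial quotient in closed form; on the interior of \<open>U\<close> it is the
  unique strip index, which resolves the definite description in \<open>gauss_code\<close>.\<close>

definition rk :: "real \<times> real \<Rightarrow> nat" where
  "rk p = nat \<lfloor>1 / fst p\<rfloor>"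

lemma strip_iff_rk:
  assumes "p \<in> interior U"
  shows "1 \<le> j \<and> p \<in> U_strip j \<longleftrightarrow> j = rk p"
proof -
  have p: "0 < snd p" "snd p < fst p" "fst p < 1" using assms by (auto simp: interior_U)
  have pU: "p \<in> U" using assms interior_subset by blast
  have f1: "1 \<le> 1 / fst p" using p by (simp add: field_simps)
  show ?thesis
  proof
    assume "1 \<le> j \<and> p \<in> U_strip j"
    then have j: "1 \<le> j" "1 / (real j + 1) < fst p" "fst p \<le> 1 / real j"
      by (auto simp: U_strip_def)
    then have "real j \<le> 1 / fst p" "1 / fst p < real j + 1"
      using p by (auto simp: field_simps)
    then have "\<lfloor>1 / fst p\<rfloor> = int j" by linarith
    then show "j = rk p" by (simp add: rk_def)
  next
    assume "j = rk p"
    then have "int j = \<lfloor>1 / fst p\<rfloor>" using p by (simp add: rk_def)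
    then have j: "real j \<le> 1 / fst p" "1 / fst p < real j + 1" "1 \<le> j"
      using f1 by linarith+
    then have "1 / (real j + 1) < fst p" "fst p \<le> 1 / real j"
      using p by (auto simp: field_simps)
    with j pU show "1 \<le> j \<and> p \<in> U_strip j" by (cases p) (auto simp: U_strip_def)
  qed
qed

lemma funpow_G_in_A: "p \<in> A \<Longrightarrow> (G ^^ n) p \<in> A"
  by (auto simp: A_def simp flip: funpow_add[THEN fun_cong, unfolded o_def])

lemma G_in_A: "p \<in> A \<Longrightarrow> G p \<in> A"
  using funpow_G_in_A[of p 1] by simp

lemma A_bounds:
  assumes "p \<in> A"
  shows "0 < snd p" "snd p < fst p" "fst p < 1" "0 < fst p" "p \<in> interior U"
proof -
  have "(G ^^ 0) p \<in> interior U" using assms unfolding A_def by blast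
  then show "0 < snd p" "snd p < fst p" "fst p < 1" "0 < fst p" "p \<in> interior U"
    by (auto simp: interior_U)
qed

lemma rk_bounds:
  assumes "p \<in> A"
  shows "1 \<le> rk p" "real (rk p) * fst p \<le> 1" "1 < (real (rk p) + 1) * fst p"
    "real_of_int \<lfloor>1 / fst p\<rfloor> = real (rk p)"
proof -
  have p: "1 \<le> 1 / fst p" "0 < fst p" using A_bounds[OF assms] by (auto simp: field_simps)
  then have i: "int (rk p) = \<lfloor>1 / fst p\<rfloor>" by (simp add: rk_def)
  then have j: "real (rk p) \<le> 1 / fst p" "1 / fst p < real (rk p) + 1" "1 \<le> rk p"
    using p by linarith+
  show "1 \<le> rk p" "real (rk p) * fst p \<le> 1" "1 < (real (rk p) + 1) * fst p"
    using j p by (auto simp: field_simps)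
  show "real_of_int \<lfloor>1 / fst p\<rfloor> = real (rk p)" using i by linarith
qed

lemma G_eqs:
  assumes "p \<in> A"
  shows "fst p * fst (G p) = snd p" "fst p * snd (G p) = snd p - 1 + real (rk p) * fst p"
  using A_bounds[OF assms] rk_bounds(4)[OF assms]
  by (cases p; simp add: G_def field_simps)+

lemma gauss_code_rk: "p \<in> A \<Longrightarrow> gauss_code p n = rk ((G ^^ n) p)"
  using strip_iff_rk A_bounds(5)[OF funpow_G_in_A] by (simp add: gauss_code_def)

lemma gauss_code_G: "gauss_code (G p) n = gauss_code p (Suc n)"
  by (simp add: gauss_code_def funpow_swap1)

lemma gauss_code_funpow_G: "gauss_code ((G ^^ m) p) n = gauss_code p (m + n)"
  by (simp add: gauss_code_def add.commute flip: funpow_add[THEN fun_cong, unfolded o_def])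

lemma gauss_code_0: "p \<in> A \<Longrightarrow> gauss_code p 0 = rk p"
  by (simp add: gauss_code_rk)

lemma fst_le_half: "p \<in> A \<Longrightarrow> rk p \<noteq> 1 \<Longrightarrow> fst p \<le> 1 / 2"
proof -
  assume p: "p \<in> A" "rk p \<noteq> 1"
  then have "2 \<le> real (rk p)" using rk_bounds(1)[OF p(1)] by linarith
  then have "2 * fst p \<le> real (rk p) * fst p" using A_bounds[OF p(1)] by simp
  then show ?thesis using rk_bounds(2)[OF p(1)] by simp
qed

subsection \<open>Codes lie in \<open>K\<close>\<close>

text \<open>Combining \<open>G_eqs\<close> at \<open>p\<close> and \<open>G p\<close> eliminates
  \<open>snd (G p)\<close>. With digit 1, two Gauss steps thus enlarge the distance to the edge
  \<open>fst = 1\<close> by the factor \<open>1 / snd p\<close>.\<close>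

lemma one_minus_fst_GG:
  assumes "p \<in> A" "rk p = 1"
  shows "1 - fst p = snd p * (1 - fst (G (G p)))"
proof -
  have b: "0 < snd p" "0 < fst p" using A_bounds[OF assms(1)] by auto
  have e: "fst p * snd (G p) = snd p - 1 + fst p" "fst p * fst (G p) = snd p"
    "fst (G p) * fst (G (G p)) = snd (G p)"
    using G_eqs[OF assms(1)] G_eqs[OF G_in_A[OF assms(1)]] assms(2) by auto
  have "snd p * fst (G (G p)) = fst p * (fst (G p) * fst (G (G p)))"
    by (simp add: e(2)[symmetric])
  also have "\<dots> = snd p - 1 + fst p" using e by simp
  finally show ?thesis by (simp add: algebra_simps)
qed

text \<open>If every even digit were 1, the distance \<open>1 - fst\<close> would grow geometrically
  along the even levels and exceed 1.\<close>

lemma ex_even_code_neq_1: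
  assumes "p \<in> A"
  shows "\<exists>i. gauss_code p (2 * i) \<noteq> 1"
proof (rule ccontr)
  assume "\<not> ?thesis"
  then have k: "rk ((G ^^ (2 * i)) p) = 1" for i by (simp add: gauss_code_rk[OF assms])
  define r where "r = fst p"
  have r: "0 < r" "r < 1" using A_bounds[OF assms] by (auto simp: r_def)
  \<comment> \<open>The bound by \<open>r\<close> is carried along because it makes the expansion
    uniform: \<open>snd \<le> fst \<le> r\<close> at every even level.\<close>
  have *: "fst ((G ^^ (2 * n)) p) \<le> r \<and> 1 - r \<le> r ^ n * (1 - fst ((G ^^ (2 * n)) p))" for n
  proof (induction n)
    case 0 then show ?case by (simp add: r_def)
  next
    case (Suc n)
    define q where "q = (G ^^ (2 * n)) p"
    have q: "q \<in> A" "rk q = 1" using k funpow_G_in_A[OF assms] by (auto simp: q_def)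
    have q2: "(G ^^ (2 * Suc n)) p = G (G q)" by (simp add: q_def)
    have GG: "0 \<le> 1 - fst (G (G q))" using A_bounds(3)[OF G_in_A[OF G_in_A[OF q(1)]]] by simp
    have "snd q \<le> r" using A_bounds(2)[OF q(1)] Suc.IH by (simp add: q_def)
    then have "1 - fst q \<le> r * (1 - fst (G (G q)))"
      using one_minus_fst_GG[OF q] GG by (simp add: mult_right_mono)
    moreover have "r * (1 - fst (G (G q))) \<le> 1 - fst (G (G q))"
      using r GG by (simp add: mult_left_le_one_le)
    moreover have "r ^ n * (1 - fst q) \<le> r ^ n * (r * (1 - fst (G (G q))))"
      using calculation(1) r by simp
    ultimately show ?case using Suc.IH unfolding q2 q_def[symmetric]
      by (auto simp: algebra_simps)
  qed
  obtain n where "r ^ n < 1 - r" using real_arch_pow_inv[of "1 - r" r] r by auto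
  moreover have "r ^ n * (1 - fst ((G ^^ (2 * n)) p)) \<le> r ^ n"
    using r A_bounds(4)[OF funpow_G_in_A[OF assms], of "2 * n"] by (intro mult_left_le) auto
  ultimately show False using *[of n] by linarith
qed

lemma gauss_code_in_K:
  assumes "p \<in> A"
  shows "gauss_code p \<in> K"
proof -
  have "\<exists>n>m. gauss_code p (2 * n + d) \<noteq> 1" for m d
  proof -
    \<comment> \<open>For \<open>d = 1\<close> the shift by an odd number of levels turns the result
      on even digits into one on odd digits; \<open>2 * Suc m\<close> pushes the digit found beyond
      \<open>m\<close>.\<close>
    obtain i where "gauss_code ((G ^^ (2 * Suc m + d)) p) (2 * i) \<noteq> 1"
      using ex_even_code_neq_1[OF funpow_G_in_A[OF assms]] by blast
    then have "gauss_code p (2 * (Suc m + i) + d) \<noteq> 1"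
      by (simp only: gauss_code_funpow_G) (simp add: algebra_simps)
    then show ?thesis by (intro exI[of _ "Suc m + i"]) auto
  qed
  from this[of _ 0] this[of _ 1] show ?thesis
    using rk_bounds(1)[OF funpow_G_in_A[OF assms]]
    by (auto simp: K_def infinite_nat_iff_unbounded gauss_code_rk[OF assms])
qed

lemma ex_code_neq_1: "p \<in> A \<Longrightarrow> \<exists>i. gauss_code p i \<noteq> 1"
  using ex_even_code_neq_1 by blast

subsection \<open>The code determines the parameter\<close>

text \<open>Multiplicative, and on first coordinates only: \<open>snd p = fst p * fst (G p)\<close>
  recovers the second ones from two consecutive levels.\<close>

definition close :: "real \<Rightarrow> real \<times> real \<Rightarrow> real \<times> real \<Rightarrow> bool" where
  "close e p q \<longleftrightarrow> fst p \<le> (1 + e) * fst q \<and> fst q \<le> (1 + e) * fst p"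

text \<open>Eliminating the second coordinates leaves a recursion of order two in the first ones, so
  closeness has to be carried at two consecutive levels.\<close>

lemma inverse_fst:
  assumes "p \<in> A"
  shows "1 / fst p = real (rk p) + fst (G p) * (1 - fst (G (G p)))"
proof -
  have "fst p * snd (G p) = fst p * fst (G p) - 1 + real (rk p) * fst p"
    using G_eqs[OF assms] by simp
  moreover have "fst (G p) * fst (G (G p)) = snd (G p)" using G_eqs[OF G_in_A[OF assms]] by simp
  ultimately show ?thesis using A_bounds(4)[OF assms] by (simp add: field_simps)
qed

lemma close_step_aux:
  assumes "p \<in> A" "q \<in> A" "rk p = rk q" "0 \<le> e" "snd p \<le> c"
    and "close e (G p) (G q)" "close e (G (G p)) (G (G q))"
  shows "fst p \<le> (1 + c * e) * fst q"
proof -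
  define x y u v where d: "x = fst (G p)" "y = fst (G (G p))" "u = fst (G q)" "v = fst (G (G q))"
  have pos: "0 < x" "0 < y" "0 < u" "0 < v" "v < 1" "y < 1"
    using A_bounds(3,4) assms(1,2) G_in_A by (auto simp: d)
  have h: "u \<le> (1 + e) * x" "y \<le> (1 + e) * v" using assms(6,7) by (auto simp: close_def d)
  have "u * (1 - v) \<le> (1 + e) * x * (1 - v)" using h pos by (intro mult_right_mono) auto
  \<comment> \<open>The factor \<open>1 + e\<close> is moved onto \<open>v\<close>, where it absorbs
    the error of \<open>y\<close>; both errors together cost a single summand
    \<open>e * x\<close>.\<close>
  also have "\<dots> = (1 + e) * x - x * ((1 + e) * v)" by (simp add: algebra_simps)
  also have "\<dots> \<le> (1 + e) * x - x * y" using h pos by simp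
  finally have "1 / fst q \<le> 1 / fst p + e * x"
    using inverse_fst[OF assms(1)] inverse_fst[OF assms(2)] assms(3)
    by (simp add: d algebra_simps)
  moreover have "fst p * x \<le> c" using G_eqs[OF assms(1)] assms(5) by (simp add: d)
  then have "e * (fst p * x) \<le> e * c" using assms(4) by (rule mult_left_mono)
  moreover have "fst p * (1 / fst q) \<le> fst p * (1 / fst p + e * x)"
    using calculation(1) A_bounds(4)[OF assms(1)] by (intro mult_left_mono) auto
  moreover have "fst p * (1 / fst p + e * x) = 1 + e * (fst p * x)"
    using A_bounds(4)[OF assms(1)] by (simp add: algebra_simps)
  ultimately have "fst p * (1 / fst q) \<le> 1 + c * e" by (simp add: mult.commute)
  then show ?thesis using A_bounds(4)[OF assms(2)] by (simp add: field_simps)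
qed

lemma close_step:
  assumes "p \<in> A" "q \<in> A" "rk p = rk q" "0 \<le> e" "snd p \<le> c" "snd q \<le> c"
    and "close e (G p) (G q)" "close e (G (G p)) (G (G q))"
  shows "close (c * e) p q"
  using close_step_aux[OF assms(1-5,7,8)] close_step_aux[OF assms(2,1) _ assms(4,6)] assms(3,7,8)
  by (auto simp: close_def)

text \<open>With the bound 1 for \<open>snd\<close> in \<open>close_step\<close>, nothing is lost on
  the way from level \<open>j\<close> back to level 0.\<close>

lemma close_from_level:
  assumes "p \<in> A" "q \<in> A" "gauss_code p = gauss_code q" "0 \<le> e"
    and "close e ((G ^^ j) p) ((G ^^ j) q)" "close e ((G ^^ Suc j) p) ((G ^^ Suc j) q)"
  shows "close e p q \<and> close e (G p) (G q)"
  using assms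
proof (induction j arbitrary: p q)
  case 0 then show ?case by simp
next
  case (Suc j)
  have rk: "rk p = rk q" using Suc.prems gauss_code_0 by metis
  have c: "gauss_code (G p) = gauss_code (G q)" using Suc.prems(3) by (auto simp: gauss_code_G)
  have "close e ((G ^^ j) (G p)) ((G ^^ j) (G q))"
    "close e ((G ^^ Suc j) (G p)) ((G ^^ Suc j) (G q))"
    using Suc.prems(5,6) by (simp_all add: funpow_swap1)
  then have 1: "close e (G p) (G q)" "close e (G (G p)) (G (G q))"
    using Suc.IH[of "G p" "G q"] Suc.prems c G_in_A by auto
  have "snd p \<le> 1" "snd q \<le> 1"
    using A_bounds[OF Suc.prems(1)] A_bounds[OF Suc.prems(2)] by linarith+
  then show ?case using close_step[OF Suc.prems(1,2) rk Suc.prems(4) _ _ 1, of 1] 1 by simp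
qed

lemma code_eq_funpow:
  "gauss_code p = gauss_code q \<Longrightarrow> gauss_code ((G ^^ n) p) = gauss_code ((G ^^ n) q)"
  by (auto simp: gauss_code_funpow_G)

text \<open>Since \<open>snd p = fst p * fst (G p)\<close>, a partial quotient \<open>\<ge> 2\<close> yields the contraction
  factor \<open>1/2\<close> at two consecutive levels.\<close>

lemma close_power:
  assumes "p \<in> A" "q \<in> A" "gauss_code p = gauss_code q"
  shows "close ((1/2) ^ N) p q"
  using assms
proof (induction N arbitrary: p q)
  case 0
  define r where "r = real (rk p)"
  have k: "rk q = rk p" using 0 gauss_code_0 by metis
  have "1 \<le> r" using rk_bounds(1)[OF 0(1)] by (simp add: r_def)
  \<comment> \<open>Since \<open>r + 1 \<le> 2 * r\<close>, both first coordinates lie between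
    \<open>1 / (2 * r)\<close> and \<open>1 / r\<close>, hence within a factor 2.\<close>
  then have "(r + 1) * fst p \<le> (2 * r) * fst p" "(r + 1) * fst q \<le> (2 * r) * fst q"
    using A_bounds(4)[OF 0(1)] A_bounds(4)[OF 0(2)] by (intro mult_right_mono; simp)+
  then have *: "r * fst p \<le> 1" "1 \<le> r * (2 * fst p)" "r * fst q \<le> 1" "1 \<le> r * (2 * fst q)"
    using rk_bounds(2,3)[OF 0(1)] rk_bounds(2,3)[OF 0(2)]
    unfolding k r_def[symmetric] by linarith+
  then have "r * fst p \<le> r * (2 * fst q)" "r * fst q \<le> r * (2 * fst p)" by linarith+
  then show ?case using \<open>1 \<le> r\<close> by (simp add: close_def)
next
  case (Suc N)
  define e :: real where "e = (1/2) ^ N"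
  have e: "0 \<le> e" by (simp add: e_def)
  \<comment> \<open>The digit is sought from position 1 on, so that it sits at level
    \<open>m + 1\<close> and has a level \<open>m\<close> before it; \<open>snd\<close> is at most
    1/2 at both.\<close>
  obtain m where "gauss_code (G p) m \<noteq> 1" using ex_code_neq_1[OF G_in_A[OF Suc.prems(1)]] by blast
  define p' q' where "p' = (G ^^ m) p" "q' = (G ^^ m) q"
  have A: "p' \<in> A" "q' \<in> A" "G p' \<in> A" "G q' \<in> A"
    using funpow_G_in_A G_in_A Suc.prems by (auto simp: p'_q'_def)
  have code: "gauss_code p' = gauss_code q'" "gauss_code (G p') = gauss_code (G q')"
    using code_eq_funpow[OF Suc.prems(3), of m] code_eq_funpow[OF Suc.prems(3), of "Suc m"]
    by (simp_all add: p'_q'_def)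
  then have rk: "rk p' = rk q'" "rk (G p') = rk (G q')" using A gauss_code_0 by metis+
  have "rk (G p') \<noteq> 1"
    using \<open>gauss_code (G p) m \<noteq> 1\<close> gauss_code_rk[OF G_in_A[OF Suc.prems(1)]]
    by (simp add: p'_q'_def funpow_swap1)
  then have h: "fst (G p') \<le> 1/2" "fst (G q') \<le> 1/2" using fst_le_half A rk by auto
  have s: "snd (G x) \<le> 1/2 \<and> snd x \<le> 1/2" if "x \<in> A" "fst (G x) \<le> 1/2" for x
  proof -
    have "fst x * fst (G x) \<le> fst (G x)"
      using A_bounds(3,4)[OF that(1)] A_bounds(4)[OF G_in_A[OF that(1)]]
      by (intro mult_left_le_one_le) auto
    then show ?thesis
      using G_eqs(1)[OF that(1)] A_bounds(2)[OF G_in_A[OF that(1)]] that(2) by simp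
  qed
  have IH: "close e ((G ^^ n) p') ((G ^^ n) q')" for n
    unfolding e_def by (rule Suc.IH) (use A(1,2) code_eq_funpow[OF code(1)] funpow_G_in_A in auto)
  have "close (1/2 * e) (G p') (G q')"
    by (rule close_step) (use A rk e s h IH[of 2] IH[of 3] in \<open>auto simp: numeral_2_eq_2 numeral_3_eq_3\<close>)
  moreover have "close (1/2 * e) p' q'"
    by (rule close_step) (use A rk e s h IH[of 1] IH[of 2] in \<open>auto simp: numeral_2_eq_2\<close>)
  ultimately have "close (1/2 * e) p q"
    using close_from_level[of p q "1/2 * e" m] Suc.prems e by (simp add: p'_q'_def)
  then show ?case by (simp add: e_def)
qed

lemma code_eq_imp_fst_eq:
  assumes "p \<in> A" "q \<in> A" "gauss_code p = gauss_code q"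
  shows "fst p = fst q"
proof -
  have *: "x \<le> y" if "\<And>N. x \<le> (1 + (1/2) ^ N) * y" for x y :: real
  proof (rule LIMSEQ_le_const)
    have "(\<lambda>N. (1 + (1/2::real) ^ N) * y) \<longlonglongrightarrow> (1 + 0) * y"
      by (intro tendsto_intros LIMSEQ_realpow_zero) auto
    then show "(\<lambda>N. (1 + (1/2::real) ^ N) * y) \<longlonglongrightarrow> y" by simp
  qed (use that in auto)
  show ?thesis
    by (rule antisym; rule *) (use close_power[OF assms] in \<open>auto simp: close_def\<close>)
qed

lemma inj_on_gauss_code: "inj_on gauss_code A"
proof
  fix p q assume *: "p \<in> A" "q \<in> A" "gauss_code p = gauss_code q"
  have "fst p = fst q" using code_eq_imp_fst_eq[OF *] .
  moreover have "fst (G p) = fst (G q)"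
    using code_eq_imp_fst_eq[of "G p" "G q"] code_eq_funpow[OF *(3), of 1] * G_in_A by simp
  ultimately show "p = q" using G_eqs(1)[OF *(1)] G_eqs(1)[OF *(2)] by (simp add: prod_eq_iff)
qed

subsection \<open>Every code in \<open>K\<close> occurs\<close>

text \<open>Solves \<open>G p = q\<close> with digit \<open>k\<close> for \<open>p\<close>: the
  difference of the coordinates of \<open>q\<close> is \<open>1 / fst p - k\<close>.\<close>

definition branch :: "nat \<Rightarrow> real \<times> real \<Rightarrow> real \<times> real" where
  "branch k q = (1 / (real k + fst q - snd q), fst q / (real k + fst q - snd q))"

lemma U_bounds: "q \<in> U \<Longrightarrow> 0 \<le> snd q \<and> snd q \<le> fst q \<and> fst q \<le> 1"
  by (auto simp: U_def)

lemma branch_in_U: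
  assumes "1 \<le> k" "q \<in> U"
  shows "branch k q \<in> U"
proof -
  have "1 \<le> real k" using assms(1) by simp
  then have D: "0 \<le> fst q" "fst q \<le> 1" "1 \<le> real k + fst q - snd q"
    using U_bounds[OF assms(2)] by linarith+
  then show ?thesis by (auto simp: branch_def U_def divide_right_mono)
qed

lemma inj_on_branch:
  assumes "1 \<le> k"
  shows "inj_on (branch k) U"
proof
  fix p q assume *: "p \<in> U" "q \<in> U" "branch k p = branch k q"
  have "1 \<le> real k" using assms by simp
  then have pos: "0 < real k + fst p - snd p" "0 < real k + fst q - snd q"
    using U_bounds[OF *(1)] U_bounds[OF *(2)] by auto
  then have D: "real k + fst p - snd p = real k + fst q - snd q"
    using *(3) by (simp add: branch_def)
  then have "fst p = fst q" using pos *(3) unfolding branch_def D by simp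
  then show "p = q" using D by (simp add: prod_eq_iff)
qed

primrec cylinder :: "(nat \<Rightarrow> nat) \<Rightarrow> nat \<Rightarrow> (real \<times> real) set" where
  "cylinder k 0 = U"
| "cylinder k (Suc m) = branch (k 0) ` cylinder (shift k) m"

text \<open>Dropping the first digit interchanges the two parity conditions, up to the even position
  0, which is lost.\<close>

lemma shift_in_K: "k \<in> K \<Longrightarrow> shift k \<in> K"
proof -
  assume k: "k \<in> K"
  have "\<exists>n>m. k (2 * Suc n) \<noteq> 1" for m
  proof -
    have "\<forall>m. \<exists>n>m. k (2 * n) \<noteq> 1" using k by (auto simp: K_def infinite_nat_iff_unbounded)
    then obtain n where "n > Suc m" "k (2 * n) \<noteq> 1" by blast
    then show ?thesis by (intro exI[of _ "n - 1"]) auto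
  qed
  then show ?thesis using k by (auto simp: K_def infinite_nat_iff_unbounded shift_def)
qed

lemma cylinder_subset_U: "k \<in> K \<Longrightarrow> cylinder k m \<subseteq> U"
proof (induction m arbitrary: k)
  case (Suc m)
  have "1 \<le> k 0" using Suc.prems by (simp add: K_def)
  then show ?case using Suc.IH[OF shift_in_K[OF Suc.prems]] branch_in_U by auto
qed simp

lemma compact_U: "compact U"
proof -
  have "U = {p. 0 \<le> snd p \<and> snd p \<le> fst p \<and> fst p \<le> 1}" by (auto simp: U_def)
  moreover have "closed {p::real \<times> real. 0 \<le> snd p \<and> snd p \<le> fst p \<and> fst p \<le> 1}"
    by (intro closed_Collect_conj closed_Collect_le continuous_intros)
  moreover have "U \<subseteq> cbox (0, 0) (1, 1)" by (auto simp: U_def)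
  ultimately show ?thesis
    by (metis bounded_cbox bounded_subset compact_eq_bounded_closed)
qed

lemma compact_cylinder: "k \<in> K \<Longrightarrow> compact (cylinder k m)"
proof (induction m arbitrary: k)
  case 0 then show ?case by (simp add: compact_U)
next
  case (Suc m)
  have k1: "1 \<le> k 0" using Suc.prems by (simp add: K_def)
  have "continuous_on U (branch (k 0))"
    unfolding branch_def
  proof (intro continuous_intros ballI)
    show "real (k 0) + fst q - snd q \<noteq> 0" if "q \<in> U" for q
      using U_bounds[OF that] k1 by linarith
    then show "real (k 0) + fst q - snd q \<noteq> 0" if "q \<in> U" for q using that .
  qed
  then have "continuous_on (cylinder (shift k) m) (branch (k 0))"
    using cylinder_subset_U[OF shift_in_K[OF Suc.prems]] continuous_on_subset by blast
  then show ?case using Suc shift_in_K by (auto intro: compact_continuous_image)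
qed

lemma cylinder_Suc_subset: "k \<in> K \<Longrightarrow> cylinder k (Suc m) \<subseteq> cylinder k m"
proof (induction m arbitrary: k)
  case 0 then show ?case using cylinder_subset_U[of k 1] by simp
next
  case (Suc m)
  then show ?case using Suc.IH[OF shift_in_K[OF Suc.prems]]
    by (simp only: cylinder.simps(2)) blast
qed

lemma ex_in_cylinders:
  assumes "k \<in> K"
  shows "\<exists>p. \<forall>m. p \<in> cylinder k m"
proof -
  have "(0, 0) \<in> U" by (simp add: U_def)
  then have ne: "cylinder k m \<noteq> {}" for k m by (induction m arbitrary: k) auto
  have "\<Inter>(range (cylinder k)) \<noteq> {}"
  proof (rule compact_nest)
    show "cylinder k n \<subseteq> cylinder k m" if "m \<le> n" for m n
      using lift_Suc_antimono_le[of "cylinder k", OF cylinder_Suc_subset[OF assms] that] .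
  qed (use compact_cylinder[OF assms] ne in auto)
  then show ?thesis by auto
qed

text \<open>Each cylinder supplies a preimage of its own; injectivity of the branch shows that they
  all coincide.\<close>

lemma cylinders_unbranch:
  assumes "k \<in> K" "\<forall>m. p \<in> cylinder k m"
  obtains q where "p = branch (k 0) q" "\<forall>m. q \<in> cylinder (shift k) m"
proof -
  have "p \<in> cylinder k (Suc 0)" using assms(2) by blast
  then obtain q where q: "q \<in> U" "p = branch (k 0) q" by auto
  have k1: "1 \<le> k 0" using assms(1) by (simp add: K_def)
  have "q \<in> cylinder (shift k) m" for m
  proof -
    have "p \<in> cylinder k (Suc m)" using assms(2) by blast
    then obtain q' where q': "q' \<in> cylinder (shift k) m" "p = branch (k 0) q'" by auto
    moreover have "q' \<in> U" using cylinder_subset_U[OF shift_in_K[OF assms(1)]] q'(1) by blast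
    ultimately have "q' = q" using q inj_onD[OF inj_on_branch[OF k1], of q' q] by simp
    then show ?thesis using q'(1) by simp
  qed
  then show ?thesis using q that by blast
qed

lemma cylinders_subset_U: "k \<in> K \<Longrightarrow> \<forall>m. p \<in> cylinder k m \<Longrightarrow> p \<in> U"
  using cylinder_subset_U by blast

lemma cylinders_snd_pos:
  assumes "k \<in> K" "\<forall>m. p \<in> cylinder k m"
  shows "0 < snd p"
proof -
  have *: "0 < fst p" if kp: "k \<in> K" "\<forall>m. p \<in> cylinder k m" for k p
  proof -
    obtain q where q: "p = branch (k 0) q" "\<forall>m. q \<in> cylinder (shift k) m"
      using cylinders_unbranch[OF kp] by blast
    have "q \<in> U" by (rule cylinders_subset_U[OF shift_in_K[OF kp(1)] q(2)])
    moreover have "1 \<le> real (k 0)" using kp(1) by (simp add: K_def)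
    ultimately have "0 < real (k 0) + fst q - snd q" using U_bounds[of q] by linarith
    then show ?thesis using q(1) by (simp add: branch_def)
  qed
  obtain q where q: "p = branch (k 0) q" "\<forall>m. q \<in> cylinder (shift k) m"
    using cylinders_unbranch[OF assms] by blast
  have "snd p = fst p * fst q" using q(1) by (simp add: branch_def)
  then show ?thesis using *[OF assms] *[OF shift_in_K[OF assms(1)] q(2)] by simp
qed

lemma cylinders_edge_diag:
  assumes "k \<in> K" "\<forall>m. p \<in> cylinder k m" "fst p = snd p"
  obtains q where "fst q = 1" "\<forall>m. q \<in> cylinder (shift k) m"
proof -
  obtain q where q: "p = branch (k 0) q" "\<forall>m. q \<in> cylinder (shift k) m"
    using cylinders_unbranch[OF assms(1,2)] by blast
  have "snd p = fst p * fst q" using q(1) by (simp add: branch_def)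
  then have "fst q = 1" using cylinders_snd_pos[OF assms(1,2)] assms(3) by simp
  then show ?thesis using q that by blast
qed

lemma cylinders_edge_right:
  assumes "k \<in> K" "\<forall>m. p \<in> cylinder k m" "fst p = 1"
  obtains q where "k 0 = 1" "fst q = snd q" "\<forall>m. q \<in> cylinder (shift k) m"
proof -
  obtain q where q: "p = branch (k 0) q" "\<forall>m. q \<in> cylinder (shift k) m"
    using cylinders_unbranch[OF assms(1,2)] by blast
  have "q \<in> U" by (rule cylinders_subset_U[OF shift_in_K[OF assms(1)] q(2)])
  then have qb: "snd q \<le> fst q" using U_bounds by blast
  have k: "1 \<le> k 0" using assms(1) by (simp add: K_def)
  have "real (k 0) + fst q - snd q = 1" using q(1) assms(3) by (simp add: branch_def)
  then have "k 0 = 1" "fst q = snd q" using qb k by linarith+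
  then show ?thesis using q that by blast
qed

text \<open>The edge \<open>fst = 1\<close> leads, with digit 1, to the diagonal, and the diagonal
  leads back to that edge. Staying in this cycle makes every even digit 1.\<close>

lemma cylinders_fst_neq_1:
  assumes "k \<in> K" "\<forall>m. p \<in> cylinder k m"
  shows "fst p \<noteq> 1"
proof
  assume "fst p = 1"
  have "k (2 * i) = 1" if "k \<in> K" "\<forall>m. p \<in> cylinder k m" "fst p = 1" for i k p
    using that
  proof (induction i arbitrary: k p)
    case 0 then show ?case using cylinders_edge_right[OF 0] by auto
  next
    case (Suc i)
    obtain q where q: "k 0 = 1" "fst q = snd q" "\<forall>m. q \<in> cylinder (shift k) m"
      using cylinders_edge_right[OF Suc.prems] by blast
    obtain r where r: "fst r = 1" "\<forall>m. r \<in> cylinder (shift (shift k)) m"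
      using cylinders_edge_diag[OF shift_in_K[OF Suc.prems(1)] q(3,2)] by blast
    have "shift (shift k) (2 * i) = 1"
      by (rule Suc.IH[OF _ r(2,1)]) (simp add: Suc.prems(1) shift_in_K)
    then show ?case by (simp add: shift_def)
  qed
  then have "{i. k (2 * i) \<noteq> 1} = {}" using assms \<open>fst p = 1\<close> by blast
  then show False using assms(1) by (auto simp: K_def)
qed

text \<open>The diagonal is excluded by applying \<open>cylinders_fst_neq_1\<close> to the shifted
  code, that is, through the odd digits.\<close>

lemma cylinders_interior:
  assumes "k \<in> K" "\<forall>m. p \<in> cylinder k m"
  shows "p \<in> interior U"
proof -
  have "fst p \<noteq> snd p"
    using cylinders_edge_diag[OF assms] cylinders_fst_neq_1[OF shift_in_K[OF assms(1)]] by metis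
  moreover have "fst p \<noteq> 1" by (rule cylinders_fst_neq_1[OF assms])
  ultimately show ?thesis using U_bounds[OF cylinders_subset_U[OF assms]] cylinders_snd_pos[OF assms]
    by (simp add: interior_U)
qed

lemma G_branch:
  assumes "q \<in> interior U" "1 \<le> k"
  shows "G (branch k q) = q" "rk (branch k q) = k"
proof -
  have q: "0 < snd q" "snd q < fst q" "fst q < 1" using assms(1) by (auto simp: interior_U)
  define D where "D = real k + fst q - snd q"
  have D: "0 < D" using q by (simp add: D_def)
  \<comment> \<open>In the interior \<open>fst q - snd q\<close> lies strictly between 0 and 1, so
    the digit read off is \<open>k\<close>.\<close>
  have fl: "\<lfloor>D\<rfloor> = int k" using q by (simp add: D_def floor_eq_iff)
  have b: "branch k q = (1 / D, fst q / D)" by (simp add: branch_def D_def)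
  show "rk (branch k q) = k" using fl by (simp add: b rk_def)
  show "G (branch k q) = q" using D fl
    by (simp add: b G_def prod_eq_iff field_simps) (simp add: D_def)
qed

lemma cylinders_gauss_code:
  assumes "k \<in> K" "\<forall>m. p \<in> cylinder k m"
  shows "p \<in> A" "gauss_code p = k"
proof -
  have *: "(G ^^ n) p \<in> interior U \<and> rk ((G ^^ n) p) = k n"
    if "k \<in> K" "\<forall>m. p \<in> cylinder k m" for n k p
    using that
  proof (induction n arbitrary: k p)
    case (0 k p)
    obtain q where q: "p = branch (k 0) q" "\<forall>m. q \<in> cylinder (shift k) m"
      using cylinders_unbranch[OF 0] by blast
    have "1 \<le> k 0" using 0(1) by (simp add: K_def)
    then show ?case
      using cylinders_interior[OF 0] G_branch(2)[OF cylinders_interior[OF shift_in_K[OF 0(1)] q(2)]] q(1)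
      by simp
  next
    case (Suc n k p)
    obtain q where q: "p = branch (k 0) q" "\<forall>m. q \<in> cylinder (shift k) m"
      using cylinders_unbranch[OF Suc.prems] by blast
    have "1 \<le> k 0" using Suc.prems(1) by (simp add: K_def)
    then have "G p = q"
      using G_branch(1)[OF cylinders_interior[OF shift_in_K[OF Suc.prems(1)] q(2)]] q(1) by simp
    then show ?case using Suc.IH[OF shift_in_K[OF Suc.prems(1)] q(2)]
      by (simp add: funpow_swap1 shift_def)
  qed
  from *[OF assms] show "p \<in> A" by (simp add: A_def)
  then show "gauss_code p = k" using *[OF assms] by (simp add: fun_eq_iff gauss_code_rk)
qed

lemma bij_betw_gauss_code: "bij_betw gauss_code A K"
  unfolding bij_betw_def
proof (intro conjI inj_on_gauss_code subset_antisym subsetI)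
  fix k assume "k \<in> K"
  then show "k \<in> gauss_code ` A" using ex_in_cylinders cylinders_gauss_code by (metis imageI)
qed (use gauss_code_in_K in auto)

section \<open>Uncountability by Cantor's diagonal argument\<close>

lemma uncountable_K: "uncountable K"
proof
  assume "countable K"
  define f :: "(nat \<Rightarrow> bool) \<Rightarrow> nat \<Rightarrow> nat" where "f b = (\<lambda>i. if b i then 2 else 3)" for b
  have "range f \<subseteq> K" by (auto simp: f_def K_def)
  moreover have "inj f" by (auto simp: inj_def f_def fun_eq_iff split: if_splits)
  ultimately have "countable (UNIV :: (nat \<Rightarrow> bool) set)"
    using \<open>countable K\<close> countable_image_inj_on countable_subset by blast
  then obtain g :: "nat \<Rightarrow> nat \<Rightarrow> bool" where g: "range g = UNIV"
    using uncountable_def by blast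
  then obtain n where "g n = (\<lambda>i. \<not> g i i)" by (metis UNIV_I rangeE)
  then show False by meson
qed

lemma uncountable_A: "uncountable A"
  using uncountable_K bij_betw_gauss_code uncountable_bij_betw by blast

section \<open>Renormalisation\<close>

text \<open>Passing from \<open>p\<close> to \<open>G p\<close> magnifies lengths by \<open>1 / fst p\<close>; infinitely many of these
  factors are at least 2.\<close>

lemma scale_induct [consumes 2, case_names base step]:
  assumes "p \<in> A" "0 < e"
    and base: "\<And>p e. p \<in> A \<Longrightarrow> 1 \<le> e \<Longrightarrow> Q p e"
    and step: "\<And>p e. p \<in> A \<Longrightarrow> 0 < e \<Longrightarrow> Q (G p) (e / fst p) \<Longrightarrow> Q p e"
  shows "Q p e"
proof -
  \<comment> \<open>Here \<open>n\<close> bounds the doublings that bring \<open>e\<close> up to 1.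
    The inner induction on \<open>m\<close> passes the levels up to a digit other than 1, along
    which \<open>e\<close> does not decrease.\<close>
  have *: "Q p e" if "p \<in> A" "0 < e" "1 \<le> e * 2 ^ n" for n p e
    using that
  proof (induction n arbitrary: p e)
    case 0 then show ?case using base by simp
  next
    case IH: (Suc n)
    obtain m where "gauss_code p m \<noteq> 1" using ex_code_neq_1[OF IH.prems(1)] by blast
    then show ?case using IH.prems
    proof (induction m arbitrary: p e)
      case 0
      then have "fst p \<le> 1/2" "0 < fst p"
        using fst_le_half gauss_code_0 A_bounds(4) by auto
      then have "2 * e \<le> e / fst p" using 0 by (simp add: field_simps)
      then have "2 * e * 2 ^ n \<le> e / fst p * 2 ^ n" by (intro mult_right_mono) auto
      moreover have "1 \<le> 2 * e * 2 ^ n" using 0 by simp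
      ultimately have "1 \<le> e / fst p * 2 ^ n" by linarith
      then have "Q (G p) (e / fst p)"
        using IH.IH[OF G_in_A[OF 0(2)]] 0(3) \<open>0 < fst p\<close> by (simp only: divide_pos_pos)
      then show ?case using step 0 by blast
    next
      case (Suc m)
      have "0 < fst p" "fst p \<le> 1" using A_bounds[OF Suc.prems(2)] by auto
      then have e: "e \<le> e / fst p" using Suc.prems by (simp add: field_simps)
      then have "e * 2 ^ Suc n \<le> e / fst p * 2 ^ Suc n" by (intro mult_right_mono) auto
      then have "Q (G p) (e / fst p)"
        using Suc.prems e by (intro Suc.IH G_in_A) (auto simp: gauss_code_G)
      then show ?case using step Suc.prems by blast
    qed
  qed
  obtain n where "1 / e < 2 ^ n" using real_arch_pow[of 2 "1 / e"] by auto
  then have "1 \<le> e * 2 ^ n" using assms(2) by (simp add: field_simps)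
  then show ?thesis using * assms by blast
qed

section \<open>Translation lengths, letters and itineraries\<close>

definition step :: "real \<times> real \<Rightarrow> nat \<Rightarrow> real" where
  "step p a = (if a = 1 then fst p else if a = 2 then snd p else snd p - 1)"

lemma T_step: "T p x = x + step p (letter p x)"
  by (cases p) (auto simp: T_def letter_def step_def)

lemma letter_eq:
  "letter p x = (if 0 \<le> x \<and> x < 1 - fst p then 1
     else if 1 - fst p \<le> x \<and> x < 1 - snd p then 2 else 3)"
  by (cases p) (auto simp: letter_def B1_def B2_def)

text \<open>The definition of \<open>T\<close> gives \<open>T p 1 = snd p\<close>, the left limit at 1, so that \<open>[0,1]\<close> is
  invariant.\<close>

lemma T_bounds:
  assumes "p \<in> A" "0 \<le> x" "x \<le> 1"
  shows "0 \<le> T p x" "T p x < 1"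
  using A_bounds[OF assms(1)] assms(2,3)
  by (auto simp: T_step letter_eq step_def split: if_splits)

lemma funpow_T_bounds:
  assumes "p \<in> A" "0 \<le> x" "x \<le> 1"
  shows "0 \<le> (T p ^^ n) x \<and> (T p ^^ n) x \<le> 1"
  by (induction n) (use assms T_bounds[OF assms(1)] in \<open>auto intro: less_imp_le\<close>)

text \<open>Itineraries under \<open>T\<close> itself, defined without reference to the attractor;
  \<open>itinerary_eq_coding\<close> identifies them with \<open>itinerary\<close>.\<close>

definition coding :: "real \<times> real \<Rightarrow> real \<Rightarrow> nat \<Rightarrow> nat" where
  "coding p x = (\<lambda>n. letter p ((T p ^^ n) x))"

lemma coding_funpow: "coding p ((T p ^^ m) x) n = coding p x (m + n)"
  by (simp add: coding_def add.commute flip: funpow_add[THEN fun_cong, unfolded o_def])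

lemma coding_eq_funpow:
  "coding p x = coding p y \<Longrightarrow> coding p ((T p ^^ m) x) = coding p ((T p ^^ m) y)"
  by (rule ext) (simp add: coding_funpow)

lemma coding_0: "coding p x 0 = letter p x"
  by (simp add: coding_def)

lemma coding_Suc: "coding p x (Suc n) = coding p (T p x) n"
  by (simp add: coding_def funpow_swap1)

lemma funpow_T_diff:
  assumes "\<forall>i<n. coding p x i = coding p y i"
  shows "(T p ^^ n) y - (T p ^^ n) x = y - x"
  using assms by (induction n) (auto simp: coding_def T_step)

section \<open>The first return map and its rescaling towards 1\<close>

definition emb :: "real \<times> real \<Rightarrow> real \<Rightarrow> real" where
  "emb p y = 1 - fst p * (1 - y)"

lemma emb_1: "emb p 1 = 1"
  by (simp add: emb_def)

lemma emb_diff: "emb p y - emb p x = fst p * (y - x)"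
  by (simp add: emb_def algebra_simps)

lemma emb_bounds:
  assumes "p \<in> A" "0 \<le> y" "y \<le> 1"
  shows "1 - fst p \<le> emb p y" "emb p y \<le> 1" "0 \<le> emb p y"
proof -
  have "0 \<le> fst p * (1 - y)" "fst p * (1 - y) \<le> fst p"
    using A_bounds(4)[OF assms(1)] assms by (auto intro: mult_left_le)
  then show "1 - fst p \<le> emb p y" "emb p y \<le> 1" "0 \<le> emb p y"
    using A_bounds(3)[OF assms(1)] by (auto simp: emb_def)
qed

lemma emb_surj:
  assumes "p \<in> A" "1 - fst p \<le> u" "u \<le> 1"
  obtains y where "0 \<le> y" "y \<le> 1" "u = emb p y"
proof
  show "0 \<le> 1 - (1 - u) / fst p" "1 - (1 - u) / fst p \<le> 1" "u = emb p (1 - (1 - u) / fst p)"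
    using assms A_bounds(4)[OF assms(1)] by (auto simp: emb_def field_simps)
qed

text \<open>The map \<open>emb p\<close> carries the discontinuity \<open>1 - fst (G p)\<close> to
  \<open>1 - snd p\<close>, because \<open>fst p * fst (G p) = snd p\<close>.\<close>

lemma letter_emb:
  assumes "p \<in> A" "0 \<le> y" "y \<le> 1"
  shows "letter p (emb p y) = (if letter (G p) y = 1 then 2 else 3)"
proof -
  have "y < 1 - fst (G p) \<longleftrightarrow> fst p * y < fst p * (1 - fst (G p))"
    using A_bounds(4)[OF assms(1)] by simp
  also have "\<dots> \<longleftrightarrow> emb p y < 1 - snd p"
    using G_eqs(1)[OF assms(1)] by (auto simp: emb_def algebra_simps)
  finally show ?thesis using emb_bounds[OF assms] assms by (auto simp: letter_eq)
qed

lemma letter_cases: "letter p x = 1 \<or> letter p x = 2 \<or> letter p x = 3"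
  by (auto simp: letter_eq)

lemma letter_1: "p \<in> A \<Longrightarrow> letter p 1 = 3"
  using A_bounds[of p] by (simp add: letter_eq)

text \<open>The first return map of \<open>T p\<close> to \<open>[1 - fst p, 1]\<close> is, up to the affine map \<open>emb p\<close>,
  the map \<open>T (G p)\<close>, and the words of the excursions are the values of \<open>\<chi>\<close>.\<close>

lemma return_map:
  assumes "p \<in> A" "0 \<le> y" "y \<le> 1" and w: "w = chi (rk p) (letter (G p) y)"
  shows "\<And>i. i < length w \<Longrightarrow> coding p (emb p y) i = w ! i"
    and "(T p ^^ length w) (emb p y) = emb p (T (G p) y)"
proof -
  have "(\<forall>i<length w. coding p (emb p y) i = w ! i) \<and>
        (T p ^^ length w) (emb p y) = emb p (T (G p) y)"
  proof (cases "letter (G p) y = 1")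
    case True
    then have "w = [2]" by (simp add: w chi_def)
    moreover have "emb p y + snd p = emb p (y + fst (G p))"
      using G_eqs(1)[OF assms(1)] by (simp add: emb_def algebra_simps)
    ultimately show ?thesis using True letter_emb[OF assms(1-3)]
      by (simp add: coding_0 T_step step_def)
  next
    case False
    define k where "k = rk p"
    have k: "1 \<le> k" using rk_bounds(1)[OF assms(1)] by (simp add: k_def)
    define j where "j = (if letter (G p) y = 2 then k else k - 1)"
    have wj: "w = 3 # replicate j 1" using False by (simp add: w chi_def j_def k_def)
    have l0: "letter p (emb p y) = 3" using False letter_emb[OF assms(1-3)] by simp
    \<comment> \<open>In the coordinate of \<open>emb p\<close>, letter 3 moves \<open>y\<close> to
      \<open>y + snd (G p) - k\<close> and each letter 1 adds 1, until \<open>j\<close> of them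
      reach \<open>T (G p) y\<close>. Before that the coordinate is at least 1 below
      \<open>T (G p) y < 1\<close>, hence negative: the point lies left of
      \<open>1 - fst p\<close>.\<close>
    have T': "T (G p) y = y + snd (G p) - real k + real j"
      using False k letter_cases[of "G p" y] by (auto simp: T_step step_def j_def of_nat_diff)
    have eq: "emb p (y + snd (G p) - real k + real i) = emb p y + snd p - 1 + real i * fst p" for i
      using G_eqs(2)[OF assms(1)] by (simp add: emb_def k_def algebra_simps)
    have ge: "1 - snd p \<le> emb p y"
      using l0 emb_bounds[OF assms(1-3)] by (auto simp: letter_eq split: if_splits)
    have l: "letter p (emb p (y + snd (G p) - real k + real i)) = 1" if "i < j" for i
    proof -
      have "real i + 1 \<le> real j" using that by linarith
      then have "y + snd (G p) - real k + real i < 0"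
        using T' T_bounds(2)[OF G_in_A[OF assms(1)] assms(2,3)] by linarith
      then have "fst p * (y + snd (G p) - real k + real i) < 0"
        using A_bounds(4)[OF assms(1)] by (simp add: mult_pos_neg)
      then have "emb p (y + snd (G p) - real k + real i) < 1 - fst p"
        by (simp add: emb_def algebra_simps)
      moreover have "0 \<le> emb p (y + snd (G p) - real k + real i)"
        unfolding eq using ge A_bounds(4)[OF assms(1)] by simp
      ultimately show ?thesis by (simp add: letter_eq)
    qed
    have it: "(T p ^^ Suc i) (emb p y) = emb p (y + snd (G p) - real k + real i)" if "i \<le> j" for i
      using that
    proof (induction i)
      case 0
      then show ?case using eq[of 0] l0 by (simp add: T_step step_def)
    next
      case (Suc i)
      then have "(T p ^^ Suc (Suc i)) (emb p y)
          = emb p (y + snd (G p) - real k + real i) + fst p"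
        using l[of i] by (simp add: T_step[of p "emb p (y + snd (G p) - real k + real i)"] step_def)
      then show ?case using eq[of i] eq[of "Suc i"] by (simp add: algebra_simps)
    qed
    have "coding p (emb p y) i = w ! i" if "i < length w" for i
    proof (cases i)
      case 0 then show ?thesis using l0 by (simp add: coding_0 wj)
    next
      case (Suc i')
      then show ?thesis using it[of i'] l[of i'] that by (simp add: coding_def wj)
    qed
    moreover have "(T p ^^ length w) (emb p y) = emb p (T (G p) y)"
      using it[of j] T' by (simp add: wj)
    ultimately show ?thesis by blast
  qed
  then show "\<And>i. i < length w \<Longrightarrow> coding p (emb p y) i = w ! i"
    and "(T p ^^ length w) (emb p y) = emb p (T (G p) y)" by blast+
qed

lemma length_chi_pos: "0 < length (chi k a)"
  by (simp add: chi_def)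

lemma nth_chi_tail: "0 < i \<Longrightarrow> i < length (chi k a) \<Longrightarrow> chi k a ! i = 1"
  by (auto simp: chi_def nth_Cons' split: if_splits)

subsection \<open>Points with the same itinerary\<close>

text \<open>The words of \<open>chi\<close> can be told apart: 2 stands alone, and
  \<open>31^k\<close> differs at position \<open>k = rk p\<close> from \<open>31^(k-1)\<close>
  followed by the next word, which starts with 2 or 3.\<close>

lemma letter_G_eq:
  assumes "p \<in> A" "0 \<le> y" "y \<le> 1"
  shows "letter (G p) y =
    (if coding p (emb p y) 0 = 2 then 1 else if coding p (emb p y) (rk p) = 1 then 2 else 3)"
proof -
  have c0: "coding p (emb p y) 0 = (if letter (G p) y = 1 then 2 else 3)"
    using letter_emb[OF assms] by (simp add: coding_0)
  have k: "1 \<le> rk p" using rk_bounds(1)[OF assms(1)] .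
  consider "letter (G p) y = 1" | "letter (G p) y = 2" | "letter (G p) y = 3"
    using letter_cases by blast
  then show ?thesis
  proof cases
    case 1 then show ?thesis using c0 by simp
  next
    case 2
    then have "coding p (emb p y) (rk p) = 1"
      using return_map(1)[OF assms refl, of "rk p"] k by (simp add: chi_def nth_Cons')
    then show ?thesis using c0 2 by simp
  next
    case 3
    have y': "0 \<le> T (G p) y" "T (G p) y \<le> 1"
      using T_bounds[OF G_in_A[OF assms(1)] assms(2,3)] by auto
    have "length (chi (rk p) 3) = rk p" using k by (simp add: chi_def)
    then have "(T p ^^ rk p) (emb p y) = emb p (T (G p) y)"
      using return_map(2)[OF assms refl] 3 by simp
    then have "coding p (emb p y) (rk p) \<noteq> 1"
      using letter_emb[OF assms(1) y'] by (simp add: coding_def)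
    then show ?thesis using c0 3 by simp
  qed
qed

text \<open>Recognisability: equal itineraries decode to equal letters, whose words have equal
  length, so decoding continues from a common return time.\<close>

lemma emb_coding_eq_imp:
  assumes "p \<in> A" "0 \<le> u" "u \<le> 1" "0 \<le> v" "v \<le> 1" "coding p (emb p u) = coding p (emb p v)"
  shows "coding (G p) u = coding (G p) v"
proof
  fix n show "coding (G p) u n = coding (G p) v n"
    using assms(2-6)
  proof (induction n arbitrary: u v)
    case 0
    show ?case
      unfolding coding_0[of "G p"] letter_G_eq[OF assms(1) 0(1,2)] letter_G_eq[OF assms(1) 0(3,4)] 0(5) ..
  next
    case (Suc n)
    define m where "m = length (chi (rk p) (letter (G p) u))"
    have l: "letter (G p) u = letter (G p) v"
      unfolding letter_G_eq[OF assms(1) Suc.prems(1,2)] letter_G_eq[OF assms(1) Suc.prems(3,4)]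
        Suc.prems(5) ..
    have "emb p (T (G p) u) = (T p ^^ m) (emb p u)" "emb p (T (G p) v) = (T p ^^ m) (emb p v)"
      using return_map(2)[OF assms(1) Suc.prems(1,2) refl]
        return_map(2)[OF assms(1) Suc.prems(3,4) refl] by (simp_all add: l m_def)
    then have "coding p (emb p (T (G p) u)) = coding p (emb p (T (G p) v))"
      using coding_eq_funpow[OF Suc.prems(5), of m] by simp
    then show ?case
      unfolding coding_Suc using T_bounds[OF G_in_A[OF assms(1)]] Suc.prems(1-4)
      by (intro Suc.IH) (auto intro: less_imp_le)
  qed
qed

lemma ex_coding_neq_1:
  assumes "p \<in> A" "0 \<le> x" "x \<le> 1"
  shows "\<exists>n. coding p x n \<noteq> 1"
proof (rule ccontr)
  assume "\<not> ?thesis"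
  then have "letter p ((T p ^^ n) x) = 1" for n by (simp add: coding_def)
  then have *: "(T p ^^ Suc n) x = (T p ^^ n) x + fst p" for n by (simp add: T_step step_def)
  have "(T p ^^ n) x = x + real n * fst p" for n
    by (induction n) (simp_all only: *, simp_all add: algebra_simps)
  moreover obtain n where "1 < real n * fst p"
    using reals_Archimedean3[OF A_bounds(4)[OF assms(1)]] by blast
  ultimately show False using funpow_T_bounds[OF assms, of n] assms(2) by simp
qed

lemma coding_inj:
  assumes "p \<in> A" "0 \<le> x" "x \<le> 1" "0 \<le> y" "y \<le> 1" "coding p x = coding p y"
  shows "x = y"
proof -
  \<comment> \<open>The bound \<open>e\<close> at \<open>p\<close> follows from the bound
    \<open>e / fst p\<close> at \<open>G p\<close>; a bound of at least 1 is trivial on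
    \<open>[0,1]\<close>.\<close>
  have "\<forall>x y. 0 \<le> x \<longrightarrow> x \<le> 1 \<longrightarrow> 0 \<le> y \<longrightarrow> y \<le> 1 \<longrightarrow> coding p x = coding p y \<longrightarrow> \<bar>x - y\<bar> \<le> e"
    if "0 < e" for e
    using assms(1) that
  proof (induction p e rule: scale_induct)
    case (base p e)
    show ?case
    proof (intro allI impI)
      fix x y :: real
      assume "0 \<le> x" "x \<le> 1" "0 \<le> y" "y \<le> 1"
      then show "\<bar>x - y\<bar> \<le> e" using base(2) by linarith
    qed
  next
    case (step p e)
    show ?case
    proof (intro allI impI)
      fix x y :: real
      assume xy: "0 \<le> x" "x \<le> 1" "0 \<le> y" "y \<le> 1" and c: "coding p x = coding p y"
      \<comment> \<open>At such a time both points lie in \<open>[1 - fst p, 1]\<close>, at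
        unchanged distance, and can be rescaled.\<close>
      obtain n where n: "coding p x n \<noteq> 1" using ex_coding_neq_1[OF step(1) xy(1,2)] by blast
      define u v where "u = (T p ^^ n) x" "v = (T p ^^ n) y"
      have uv: "v - u = y - x" using funpow_T_diff[of n p x y] c by (simp add: u_v_def)
      have b: "0 \<le> u" "u \<le> 1" "0 \<le> v" "v \<le> 1"
        using funpow_T_bounds[OF step(1)] xy by (auto simp: u_v_def)
      have cuv: "coding p u = coding p v" unfolding u_v_def by (rule coding_eq_funpow[OF c])
      have "letter p u \<noteq> 1" "letter p v \<noteq> 1"
        using n fun_cong[OF c, of n] by (simp_all add: u_v_def coding_def)
      then have "1 - fst p \<le> u" "1 - fst p \<le> v" using b by (auto simp: letter_eq split: if_splits)
      then obtain u' v' where u': "0 \<le> u'" "u' \<le> 1" "u = emb p u'"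
        and v': "0 \<le> v'" "v' \<le> 1" "v = emb p v'"
        by (metis emb_surj[OF step(1) _ b(2)] emb_surj[OF step(1) _ b(4)])
      have "coding (G p) u' = coding (G p) v'"
        using emb_coding_eq_imp[OF step(1) u'(1,2) v'(1,2)] cuv unfolding u'(3) v'(3) .
      then have "\<bar>u' - v'\<bar> \<le> e / fst p" using step(3) u'(1,2) v'(1,2) by blast
      moreover have "\<bar>u - v\<bar> = fst p * \<bar>u' - v'\<bar>"
        using A_bounds(4)[OF step(1)] unfolding u'(3) v'(3) emb_diff by (simp add: abs_mult)
      moreover have "\<bar>u - v\<bar> = \<bar>x - y\<bar>" using uv by linarith
      ultimately show "\<bar>x - y\<bar> \<le> e"
        using A_bounds(4)[OF step(1)] by (simp add: pos_le_divide_eq mult.commute)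
    qed
  qed
  from this[rule_format, OF _ assms(2-6)] have "\<bar>x - y\<bar> \<le> 0 + e" if "0 < e" for e
    using that unfolding add_0 .
  then have "\<bar>x - y\<bar> \<le> 0" by (rule field_le_epsilon)
  then show ?thesis by simp
qed

section \<open>The attractor\<close>

lemma Omega_n_0: "Omega_n p 0 = {0..<1}"
  by (simp add: Omega_n_def)

lemma Omega_n_Suc: "Omega_n p (Suc n) = T p ` Omega_n p n"
  by (simp add: Omega_n_def)

lemma Omega_n_Suc_subset:
  assumes "p \<in> A"
  shows "Omega_n p (Suc n) \<subseteq> Omega_n p n"
proof (induction n)
  case 0
  show ?case
  proof
    fix y assume "y \<in> Omega_n p (Suc 0)"
    then obtain x where "0 \<le> x" "x \<le> 1" "y = T p x" by (auto simp: Omega_n_Suc Omega_n_0)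
    then show "y \<in> Omega_n p 0" using T_bounds[OF assms, of x] by (simp add: Omega_n_0)
  qed
next
  case (Suc n)
  then show ?case unfolding Omega_n_Suc[of p "Suc n"] Omega_n_Suc[of p n] by (rule image_mono)
qed

lemma Omega_n_antimono: "p \<in> A \<Longrightarrow> m \<le> n \<Longrightarrow> Omega_n p n \<subseteq> Omega_n p m"
  by (rule lift_Suc_antimono_le[of "Omega_n p"]) (rule Omega_n_Suc_subset)

lemma Omega_bounds: "x \<in> Omega p \<Longrightarrow> 0 \<le> x \<and> x < 1"
proof -
  assume "x \<in> Omega p"
  then have "x \<in> Omega_n p 0" unfolding Omega_def by blast
  then show ?thesis by (simp add: Omega_n_0)
qed

lemma Omega_n_funpow: "x \<in> Omega_n p n \<Longrightarrow> (T p ^^ m) x \<in> Omega_n p (n + m)"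
  by (induction m) (auto simp: Omega_n_Suc)

lemma T_Omega:
  assumes "p \<in> A" "x \<in> Omega p"
  shows "T p x \<in> Omega p"
proof -
  have "T p x \<in> Omega_n p (Suc n)" for n using assms(2) by (auto simp: Omega_def Omega_n_Suc)
  then have "T p x \<in> Omega_n p n" for n using Omega_n_Suc_subset[OF assms(1)] by blast
  then show ?thesis by (simp add: Omega_def)
qed

text \<open>One step of \<open>T (G p)\<close> amounts to at least one step of \<open>T p\<close>,
  so depth in the nested images is not lost.\<close>

lemma emb_Omega_n:
  assumes "p \<in> A" "y \<in> Omega_n (G p) n"
  shows "emb p y \<in> Omega_n p n"
  using assms(2)
proof (induction n arbitrary: y)
  case 0
  then have "0 < fst p * (1 - y)" using A_bounds(4)[OF assms(1)] by (simp add: Omega_n_0)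
  then have "emb p y < emb p 1" using emb_diff[of p 1 y] by linarith
  then show ?case using 0 emb_bounds[OF assms(1)] by (simp add: Omega_n_0 emb_1)
next
  case (Suc n)
  then obtain z where z: "z \<in> Omega_n (G p) n" "y = T (G p) z" by (auto simp: Omega_n_Suc)
  have "z \<in> Omega_n (G p) 0" using Omega_n_antimono[OF G_in_A[OF assms(1)], of 0 n] z(1) by auto
  then have zb: "0 \<le> z" "z \<le> 1" by (auto simp: Omega_n_0)
  define m where "m = length (chi (rk p) (letter (G p) z))"
  have "emb p y = (T p ^^ m) (emb p z)" using return_map(2)[OF assms(1) zb refl] z(2) by (simp add: m_def)
  then have "emb p y \<in> Omega_n p (n + m)" using Omega_n_funpow Suc.IH[OF z(1)] by simp
  moreover have "Suc n \<le> n + m" using length_chi_pos[of "rk p"] by (simp add: m_def Suc_leI)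
  ultimately show ?case using Omega_n_antimono[OF assms(1), of "Suc n" "n + m"] by blast
qed

lemma emb_Omega: "p \<in> A \<Longrightarrow> y \<in> Omega (G p) \<Longrightarrow> emb p y \<in> Omega p"
  by (simp add: Omega_def emb_Omega_n)

lemma emb_0: "emb p 0 = 1 - fst p"
  by (simp add: emb_def)

lemma emb_emb_0: "p \<in> A \<Longrightarrow> emb p (emb (G p) 0) = 1 - snd p"
  using G_eqs(1)[of p] by (simp add: emb_def algebra_simps)

text \<open>The point 0 is the image of \<open>1 - snd p\<close>, which comes from the point 0 two levels up.\<close>

lemma zero_in_Omega: "p \<in> A \<Longrightarrow> 0 \<in> Omega p"
proof -
  have "0 \<in> Omega_n p n" if "p \<in> A" for n p
    using that
  proof (induction n arbitrary: p)
    case 0 then show ?case by (simp add: Omega_n_0)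
  next
    case (Suc n)
    have "0 \<in> Omega_n (G (G p)) n" by (intro Suc.IH G_in_A Suc.prems)
    from emb_Omega_n[OF Suc.prems emb_Omega_n[OF G_in_A[OF Suc.prems] this]]
    have "1 - snd p \<in> Omega_n p n" by (simp add: emb_emb_0[OF Suc.prems])
    moreover have "T p (1 - snd p) = 0"
      using A_bounds[OF Suc.prems] by (simp add: T_step step_def letter_eq)
    ultimately show ?case unfolding Omega_n_Suc by (intro image_eqI[of _ _ "1 - snd p"]) auto
  qed
  then show "p \<in> A \<Longrightarrow> 0 \<in> Omega p" by (simp add: Omega_def)
qed

text \<open>Both are rescaled copies of 0, from one and two levels up. Lying in
  \<open>Omega p\<close> itself, they are not among the points where \<open>Tbar\<close> takes a
  left limit.\<close>

lemma discontinuities_in_Omega: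
  assumes "p \<in> A"
  shows "1 - fst p \<in> Omega p" "1 - snd p \<in> Omega p"
  using emb_Omega[OF assms zero_in_Omega[OF G_in_A[OF assms]]]
    emb_Omega[OF assms emb_Omega[OF G_in_A[OF assms] zero_in_Omega[OF G_in_A[OF G_in_A[OF assms]]]]]
  by (simp_all add: emb_0[of p] emb_emb_0[OF assms])

definition orb :: "real \<times> real \<Rightarrow> real set" where
  "orb p = range (\<lambda>n. (T p ^^ n) 1)"

lemma one_in_orb: "1 \<in> orb p"
  unfolding orb_def by (rule range_eqI[of _ _ 0]) simp

lemma funpow_T_orb: "x \<in> orb p \<Longrightarrow> (T p ^^ n) x \<in> orb p"
proof -
  assume "x \<in> orb p"
  then obtain m where "x = (T p ^^ m) 1" by (auto simp: orb_def)
  then have "(T p ^^ n) x = (T p ^^ (n + m)) 1" by (simp add: funpow_add)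
  then show ?thesis by (simp add: orb_def)
qed

lemma T_orb: "x \<in> orb p \<Longrightarrow> T p x \<in> orb p"
  using funpow_T_orb[of x p 1] by simp

lemma orb_bounds: "p \<in> A \<Longrightarrow> x \<in> orb p \<Longrightarrow> 0 \<le> x \<and> x \<le> 1"
  using funpow_T_bounds[of p 1] by (auto simp: orb_def)

lemma emb_orb:
  assumes "p \<in> A" "z \<in> orb (G p)"
  shows "emb p z \<in> orb p"
proof -
  have "emb p ((T (G p) ^^ n) 1) \<in> orb p" for n
  proof (induction n)
    case 0 then show ?case by (simp add: emb_1 one_in_orb)
  next
    case (Suc n)
    have b: "0 \<le> (T (G p) ^^ n) 1" "(T (G p) ^^ n) 1 \<le> 1"
      using funpow_T_bounds[OF G_in_A[OF assms(1)], of 1 n] by auto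
    show ?case
      unfolding funpow.simps(2) o_apply return_map(2)[OF assms(1) b refl, symmetric]
      by (rule funpow_T_orb[OF Suc])
  qed
  then show ?thesis using assms(2) by (auto simp: orb_def)
qed

subsection \<open>The closure of the attractor\<close>

text \<open>A limit point of one of the three pieces keeps the letter of that piece unless it is the
  right end of the first or second branch; both of these ends are translated to 1, the start of
  \<open>orb p\<close>.\<close>

lemma closure_Omega_n: "closure (Omega_n p n) \<subseteq> Omega_n p n \<union> orb p" if "p \<in> A"
proof (induction n)
  case 0
  have "closure (Omega_n p 0) \<subseteq> {0..1}" by (intro closure_minimal) (auto simp: Omega_n_0)
  moreover have "{0..1} \<subseteq> Omega_n p 0 \<union> {1}" by (auto simp: Omega_n_0)
  ultimately show ?case using one_in_orb by blast
next
  case (Suc n)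
  have b: "0 < snd p" "snd p < fst p" "fst p < 1" using A_bounds[OF that] by auto
  define P where "P a = {x \<in> Omega_n p n. letter p x = a}" for a
  have sub: "Omega_n p n \<subseteq> {0..<1}" using Omega_n_antimono[OF that, of 0 n] by (simp add: Omega_n_0)
  have "Omega_n p (Suc n) \<subseteq> (\<Union>a\<in>{1,2,3}. (+) (step p a) ` P a)"
  proof
    fix y assume "y \<in> Omega_n p (Suc n)"
    then obtain x where x: "x \<in> Omega_n p n" "y = T p x" by (auto simp: Omega_n_Suc)
    then have "x \<in> P (letter p x)" "y = step p (letter p x) + x" by (auto simp: P_def T_step)
    then show "y \<in> (\<Union>a\<in>{1,2,3}. (+) (step p a) ` P a)" using letter_cases[of p x] by blast
  qed
  then have "closure (Omega_n p (Suc n)) \<subseteq> closure (\<Union>a\<in>{1,2,3}. (+) (step p a) ` P a)"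
    by (rule closure_mono)
  also have "\<dots> = (\<Union>a\<in>{1,2,3}. (+) (step p a) ` closure (P a))"
    by (simp add: closure_translation)
  finally have c: "closure (Omega_n p (Suc n)) \<subseteq> \<dots>" .
  have "step p a + z \<in> Omega_n p (Suc n) \<union> orb p" if "a \<in> {1,2,3}" "z \<in> closure (P a)" for a z
  proof -
    have "z \<in> closure (Omega_n p n)" using that(2) closure_mono[of "P a" "Omega_n p n"]
      by (auto simp: P_def)
    then have z: "z \<in> Omega_n p n \<union> orb p" using Suc by blast
    define I where "I = (if a = 1 then {0..1 - fst p} else if a = 2 then {1 - fst p..1 - snd p}
      else {1 - snd p..1})"
    have "P a \<subseteq> I" using sub that(1) by (auto simp: P_def I_def letter_eq split: if_splits)
    then have "closure (P a) \<subseteq> I" by (rule closure_minimal) (simp add: I_def)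
    then have "z \<in> I" using that(2) by blast
    then have "letter p z = a \<or> step p a + z = 1"
      using that(1) b by (auto simp: I_def letter_eq step_def split: if_splits)
    then show ?thesis
    proof
      assume "letter p z = a"
      then have "step p a + z = T p z" by (simp add: T_step)
      then show ?thesis using z T_orb[of z p] by (auto simp: Omega_n_Suc)
    qed (simp add: one_in_orb)
  qed
  then show ?case using c by blast
qed

lemma closure_Omega:
  assumes "p \<in> A"
  shows "closure (Omega p) \<subseteq> Omega p \<union> orb p"
proof -
  have "closure (Omega p) \<subseteq> closure (Omega_n p n)" for n
    by (rule closure_mono) (auto simp: Omega_def)
  then have "closure (Omega p) \<subseteq> Omega_n p n \<union> orb p" for n
    using closure_Omega_n[OF assms, of n] by blast
  then show ?thesis unfolding Omega_def by blast
qed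

lemma closure_Omega_bounds:
  assumes "p \<in> A" "x \<in> closure (Omega p)"
  shows "0 \<le> x" "x \<le> 1"
proof -
  have "x \<in> Omega p \<or> x \<in> orb p" using closure_Omega[OF assms(1)] assms(2) by blast
  then show "0 \<le> x" "x \<le> 1" using Omega_bounds[of x p] orb_bounds[OF assms(1), of x] by auto
qed

section \<open>Continuity of \<open>T\<close> and its extension to the closure\<close>

lemma letter_cong:
  assumes "(0 \<le> z) = (0 \<le> x)" "(1 - fst p \<le> z) = (1 - fst p \<le> x)"
    "(1 - snd p \<le> z) = (1 - snd p \<le> x)"
  shows "letter p z = letter p x"
proof -
  have "(z < 1 - fst p) = (x < 1 - fst p)" "(z < 1 - snd p) = (x < 1 - snd p)"
    using assms(2,3) by linarith+
  then show ?thesis unfolding letter_eq using assms by simp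
qed

text \<open>The point 0 is excluded since negative numbers get the letter 3 by default.\<close>

lemma letter_locally_constant:
  assumes "x \<notin> {0, 1 - fst p, 1 - snd p}"
  shows "\<forall>\<^sub>F z in nhds x. letter p z = letter p x"
proof -
  have *: "\<forall>\<^sub>F z in nhds x. (c \<le> z) = (c \<le> x)" if "x \<noteq> c" for c
  proof (cases "c < x")
    case True
    then show ?thesis using eventually_nhds_in_open[of "{c<..}" x] by (auto elim: eventually_mono)
  next
    case False
    then show ?thesis using that eventually_nhds_in_open[of "{..<c}" x] by (auto elim: eventually_mono)
  qed
  have "\<forall>\<^sub>F z in nhds x. (0 \<le> z) = (0 \<le> x) \<and> (1 - fst p \<le> z) = (1 - fst p \<le> x)
      \<and> (1 - snd p \<le> z) = (1 - snd p \<le> x)"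
    using assms by (intro eventually_conj *) auto
  then show ?thesis by (rule eventually_mono) (intro letter_cong; simp)
qed

lemma isCont_T:
  assumes "x \<notin> {0, 1 - fst p, 1 - snd p}"
  shows "isCont (T p) x"
proof -
  have "isCont (\<lambda>z. z + step p (letter p x)) x" by (intro continuous_intros)
  moreover have "\<forall>\<^sub>F z in nhds x. T p z = z + step p (letter p x)"
    using letter_locally_constant[OF assms] by (rule eventually_mono) (simp add: T_step)
  ultimately show ?thesis by (simp add: isCont_cong)
qed

lemma closure_minus_Omega:
  assumes "p \<in> A" "x \<in> closure (Omega p) - Omega p"
  shows "x \<notin> {0, 1 - fst p, 1 - snd p}"
  using assms(2) zero_in_Omega[OF assms(1)] discontinuities_in_Omega[OF assms(1)] by auto

text \<open>The points added by the closure are not discontinuities, so the left limit there is the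
  value of \<open>T\<close>.\<close>

lemma Tbar_eq_T:
  assumes "p \<in> A"
  shows "Tbar p x = T p x"
proof (cases "x \<in> closure (Omega p) - Omega p")
  case True
  then have "isCont (T p) x" using isCont_T closure_minus_Omega[OF assms] by blast
  then have "(T p \<longlongrightarrow> T p x) (at_left x)"
    using continuous_at_imp_continuous_at_within continuous_within by blast
  then have "Lim (at_left x) (T p) = T p x" by (intro tendsto_Lim) auto
  then show ?thesis using True by (simp add: Tbar_def)
next
  case False
  then show ?thesis unfolding Tbar_def by (simp only: if_False)
qed

lemma T_closure_Omega:
  assumes "p \<in> A" "x \<in> closure (Omega p)"
  shows "T p x \<in> closure (Omega p)"
proof (cases "x \<in> Omega p")
  case True
  then show ?thesis using T_Omega[OF assms(1)] closure_subset by blast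
next
  case False
  then have c: "isCont (T p) x" using isCont_T closure_minus_Omega[OF assms(1)] assms(2) by blast
  obtain f where f: "\<forall>n. f n \<in> Omega p" "f \<longlonglongrightarrow> x"
    using assms(2) unfolding closure_sequential by blast
  then have "\<forall>n. T p (f n) \<in> Omega p" using T_Omega[OF assms(1)] by blast
  then show ?thesis
    unfolding closure_sequential
    by (intro exI[of _ "\<lambda>n. T p (f n)"] conjI isCont_tendsto_compose[OF c f(2)])
qed

lemma funpow_T_closure_Omega:
  "p \<in> A \<Longrightarrow> x \<in> closure (Omega p) \<Longrightarrow> (T p ^^ n) x \<in> closure (Omega p)"
  by (induction n) (auto intro: T_closure_Omega)

lemma itinerary_eq_coding: "p \<in> A \<Longrightarrow> itinerary p x = coding p x"
proof -
  assume "p \<in> A"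
  from Tbar_eq_T[OF this] have "Tbar p = T p" by (rule ext)
  then show ?thesis by (simp add: itinerary_def coding_def)
qed

text \<open>The point 0 lies in \<open>Omega\<close> at every level; embedding it from far up gives
  points of \<open>Omega p\<close> close to 1.\<close>

lemma one_in_closure_Omega:
  assumes "p \<in> A"
  shows "1 \<in> closure (Omega p)"
proof -
  have "\<exists>x\<in>Omega p. 1 - e \<le> x" if "0 < e" for e
    using assms that
  proof (induction p e rule: scale_induct)
    case (base p e)
    then show ?case by (intro bexI[of _ 0] zero_in_Omega) auto
  next
    case (step p e)
    then obtain x where x: "x \<in> Omega (G p)" "1 - e / fst p \<le> x" by blast
    then have "fst p * (1 - x) \<le> e" using A_bounds(4)[OF step(1)] by (simp add: field_simps)
    then show ?case using emb_Omega[OF step(1) x(1)]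
      by (intro bexI[of _ "emb p x"]) (simp_all add: emb_def)
  qed
  note * = this
  show ?thesis unfolding closure_approachable
  proof (intro allI impI)
    fix e :: real assume "0 < e"
    then obtain x where "x \<in> Omega p" "1 - e / 2 \<le> x" using *[of "e / 2"] by auto
    then show "\<exists>y\<in>Omega p. dist y 1 < e"
      using Omega_bounds[of x p] \<open>0 < e\<close> by (intro bexI[of _ x]) (auto simp: dist_real_def)
  qed
qed

subsection \<open>Desubstitution of points of the attractor\<close>

text \<open>There are only three candidates for a preimage: if each were missing from some
  \<open>Omega_n\<close>, a common depth \<open>N\<close> would exclude them all.\<close>

lemma Omega_preimage:
  assumes "p \<in> A" "x \<in> Omega p"
  shows "\<exists>u\<in>Omega p. T p u = x"
proof (rule ccontr)
  assume "\<not> ?thesis"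
  then have no: "u \<notin> Omega p" if "T p u = x" for u using that by blast
  have "\<exists>n. T p (x - step p a) = x \<longrightarrow> x - step p a \<notin> Omega_n p n" for a
    using no[of "x - step p a"] by (auto simp: Omega_def)
  then obtain n where n: "T p (x - step p a) = x \<Longrightarrow> x - step p a \<notin> Omega_n p (n a)" for a
    by metis
  define N where "N = n 1 + n 2 + n 3"
  have "x \<in> Omega_n p (Suc N)" using assms(2) by (simp add: Omega_def)
  then obtain u where u: "u \<in> Omega_n p N" "x = T p u" by (auto simp: Omega_n_Suc)
  define a where "a = letter p u"
  have "x - step p a = u" using u(2) by (simp add: T_step a_def)
  then have "u \<notin> Omega_n p (n a)" using n[of a] u(2) by simp
  moreover have "n a \<le> N" using letter_cases[of p u] by (auto simp: a_def N_def)
  then have "Omega_n p N \<subseteq> Omega_n p (n a)" by (rule Omega_n_antimono[OF assms(1)])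
  ultimately show False using u(1) by blast
qed

text \<open>Preimages in \<open>Omega p\<close> are followed backwards until a letter other than 1
  appears. Each backward step through a letter 1 lowers the point by \<open>fst p\<close>, so the
  search ends.\<close>

lemma Omega_entry:
  assumes "p \<in> A" "x \<in> Omega p"
  shows "\<exists>u\<in>Omega p. \<exists>j. 1 - fst p \<le> u \<and> (T p ^^ j) u = x \<and>
    (\<forall>i. 0 < i \<longrightarrow> i \<le> j \<longrightarrow> letter p ((T p ^^ i) u) = 1)"
proof -
  have *: "\<exists>u\<in>Omega p. \<exists>j. 1 - fst p \<le> u \<and> (T p ^^ j) u = x \<and>
      (\<forall>i. 0 < i \<longrightarrow> i \<le> j \<longrightarrow> letter p ((T p ^^ i) u) = 1)"
    if "x < real n * fst p" "x \<in> Omega p" for n x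
    using that
  proof (induction n arbitrary: x)
    case 0 then show ?case using Omega_bounds[of x p] by simp
  next
    case (Suc n)
    show ?case
    proof (cases "1 - fst p \<le> x")
      case True
      then show ?thesis using Suc.prems(2) by (intro bexI[of _ x] exI[of _ 0]) auto
    next
      case False
      have x: "0 \<le> x" using Omega_bounds[OF Suc.prems(2)] by simp
      then have lx: "letter p x = 1" using False by (simp add: letter_eq)
      obtain u0 where u0: "u0 \<in> Omega p" "T p u0 = x" using Omega_preimage[OF assms(1) Suc.prems(2)] by blast
      have "\<exists>u\<in>Omega p. \<exists>j. 1 - fst p \<le> u \<and> (T p ^^ j) u = u0 \<and>
        (\<forall>i. 0 < i \<longrightarrow> i \<le> j \<longrightarrow> letter p ((T p ^^ i) u) = 1)"
      proof (cases "letter p u0 = 1")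
        case True
        then have "u0 < real n * fst p"
          using u0(2) Suc.prems(1) by (simp add: T_step step_def algebra_simps)
        then show ?thesis using Suc.IH u0(1) by blast
      next
        case False
        then have "1 - fst p \<le> u0" using Omega_bounds[OF u0(1)] by (auto simp: letter_eq split: if_splits)
        then show ?thesis using u0(1) by (intro bexI[of _ u0] exI[of _ 0]) auto
      qed
      then obtain u j where u: "u \<in> Omega p" "1 - fst p \<le> u" "(T p ^^ j) u = u0"
        "\<And>i. 0 < i \<Longrightarrow> i \<le> j \<Longrightarrow> letter p ((T p ^^ i) u) = 1" by blast
      have Tj: "(T p ^^ Suc j) u = x" using u(3) u0(2) by simp
      have "letter p ((T p ^^ i) u) = 1" if "0 < i" "i \<le> Suc j" for i
      proof (cases "i = Suc j")
        case True then show ?thesis using Tj lx by simp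
      next
        case False then show ?thesis using u(4) that by simp
      qed
      then show ?thesis using u(1,2) Tj by blast
    qed
  qed
  obtain n where "x < real n * fst p" using reals_Archimedean3[OF A_bounds(4)[OF assms(1)]] by blast
  then show ?thesis using * assms(2) by blast
qed

lemma excursion_letter_1:
  assumes "p \<in> A" "0 \<le> y" "y \<le> 1" "0 < i" "i < length (chi (rk p) (letter (G p) y))"
  shows "letter p ((T p ^^ i) (emb p y)) = 1"
  using return_map(1)[OF assms(1-3) refl assms(5)] nth_chi_tail[OF assms(4,5)]
  by (simp add: coding_def)

lemma return_letter_neq_1:
  assumes "p \<in> A" "0 \<le> y" "y \<le> 1"
  shows "letter p ((T p ^^ length (chi (rk p) (letter (G p) y))) (emb p y)) \<noteq> 1"
proof -
  have "0 \<le> T (G p) y" "T (G p) y \<le> 1" using T_bounds[OF G_in_A[OF assms(1)] assms(2,3)] by auto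
  then show ?thesis unfolding return_map(2)[OF assms refl] using letter_emb[OF assms(1)] by simp
qed

text \<open>Converse of \<open>emb_Omega\<close>: followed backwards, \<open>emb p y\<close> comes
  from some \<open>emb p z\<close> in \<open>Omega p\<close> with \<open>y = T (G p) z\<close>, so
  each round gains one level of depth.\<close>

lemma Omega_emb_preimage:
  assumes "p \<in> A" "emb p y \<in> Omega p" "0 \<le> y" "y \<le> 1"
  shows "y \<in> Omega (G p)"
proof -
  have "y \<in> Omega_n (G p) n" for n
    using assms(2-4)
  proof (induction n arbitrary: y)
    case 0
    have "y \<noteq> 1" using Omega_bounds[OF 0(1)] by (auto simp: emb_1)
    then show ?case using 0 by (simp add: Omega_n_0)
  next
    case (Suc n)
    obtain u0 where u0: "u0 \<in> Omega p" "T p u0 = emb p y"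
      using Omega_preimage[OF assms(1) Suc.prems(1)] by blast
    obtain v j where v: "v \<in> Omega p" "1 - fst p \<le> v" "(T p ^^ j) v = u0"
      "\<And>i. 0 < i \<Longrightarrow> i \<le> j \<Longrightarrow> letter p ((T p ^^ i) v) = 1"
      using Omega_entry[OF assms(1) u0(1)] by blast
    have "v \<le> 1" using Omega_bounds[OF v(1)] by simp
    then obtain z where z: "0 \<le> z" "z \<le> 1" "v = emb p z" by (rule emb_surj[OF assms(1) v(2)])
    have Tj: "(T p ^^ Suc j) v = emb p y" using v(3) u0(2) by simp
    define m where "m = length (chi (rk p) (letter (G p) z))"
    \<comment> \<open>Both are the first positive time at which the orbit of \<open>v\<close> shows
      a letter other than 1, the return time.\<close>
    have "m = Suc j"
    proof (rule linorder_cases)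
      assume "m < Suc j"
      then have "letter p ((T p ^^ m) v) = 1"
        using v(4)[of m] length_chi_pos[of "rk p" "letter (G p) z"] by (simp add: m_def)
      then show ?thesis using return_letter_neq_1[OF assms(1) z(1,2)] by (simp add: m_def z(3))
    next
      assume "Suc j < m"
      then have "letter p ((T p ^^ Suc j) v) = 1"
        using excursion_letter_1[OF assms(1) z(1,2), of "Suc j"] by (simp only: m_def z(3))
      then show ?thesis
        using letter_emb[OF assms(1) Suc.prems(2,3)] unfolding Tj by (simp split: if_splits)
    qed
    then have "emb p y = emb p (T (G p) z)"
      using return_map(2)[OF assms(1) z(1,2) refl] Tj by (simp only: m_def z(3))
    then have "y = T (G p) z" using A_bounds(4)[OF assms(1)] by (simp add: emb_def)
    moreover have "z \<in> Omega_n (G p) n" using Suc.IH[of z] v(1) z by simp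
    ultimately show ?case by (auto simp: Omega_n_Suc)
  qed
  then show ?thesis by (simp add: Omega_def)
qed

text \<open>Thus \<open>Omega p\<close> is a tower over the embedded \<open>Omega (G p)\<close>,
  with floors indexed by the positions in the words of \<open>chi\<close>.\<close>

lemma Omega_desubst:
  assumes "p \<in> A" "x \<in> Omega p"
  obtains y j where "y \<in> Omega (G p)" "j < length (chi (rk p) (letter (G p) y))"
    "x = (T p ^^ j) (emb p y)"
proof -
  obtain u j where u: "u \<in> Omega p" "1 - fst p \<le> u" "(T p ^^ j) u = x"
    "\<And>i. 0 < i \<Longrightarrow> i \<le> j \<Longrightarrow> letter p ((T p ^^ i) u) = 1"
    using Omega_entry[OF assms] by blast
  have "u \<le> 1" using Omega_bounds[OF u(1)] by simp
  then obtain y where y: "0 \<le> y" "y \<le> 1" "u = emb p y" by (rule emb_surj[OF assms(1) u(2)])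
  define m where "m = length (chi (rk p) (letter (G p) y))"
  have "j < m"
  proof (rule ccontr)
    assume "\<not> j < m"
    then have "letter p ((T p ^^ m) u) = 1"
      using u(4)[of m] length_chi_pos[of "rk p" "letter (G p) y"] by (simp add: m_def)
    then show False using return_letter_neq_1[OF assms(1) y(1,2)] by (simp add: m_def y(3))
  qed
  moreover have "y \<in> Omega (G p)" using Omega_emb_preimage[OF assms(1) _ y(1,2)] u(1) y(3) by simp
  ultimately show ?thesis using that u(3) y(3) by (simp add: m_def)
qed

section \<open>The orbit of 1\<close>

lemma orb_letter_2:
  assumes "p \<in> A" "z \<in> orb (G p)" "letter (G p) z = 1"
  shows "emb p z \<in> orb p" "letter p (emb p z) = 2"
  using emb_orb[OF assms(1,2)] letter_emb[OF assms(1)] orb_bounds[OF G_in_A[OF assms(1)] assms(2)]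
    assms(3) by simp_all

text \<open>An even digit \<open>k \<ge> 2\<close> produces the letter, as the excursion of 1 is
  then \<open>31^(k-1)\<close>. Two levels transport it down: 1 becomes 2, and 2 becomes a word
  \<open>31^k\<close>.\<close>

lemma orb_letter_1:
  assumes "p \<in> A"
  shows "\<exists>z\<in>orb p. letter p z = 1"
proof -
  obtain i where "gauss_code p (2 * i) \<noteq> 1" using ex_even_code_neq_1[OF assms] by blast
  then show ?thesis using assms
  proof (induction i arbitrary: p)
    case (0 p)
    have k: "1 < rk p" using 0 rk_bounds(1)[OF 0(2)] gauss_code_0[OF 0(2)] by simp
    have "letter (G p) 1 = 3" by (rule letter_1[OF G_in_A[OF 0(2)]])
    then have "letter p ((T p ^^ 1) (emb p 1)) = 1"
      using k by (intro excursion_letter_1[OF 0(2)]) (auto simp: chi_def)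
    then show ?case
      using T_orb[OF one_in_orb, of p] by (intro bexI[of _ "T p 1"]) (simp_all add: emb_1)
  next
    case (Suc i p)
    have GG: "G (G p) \<in> A" by (intro G_in_A Suc.prems(2))
    have "gauss_code (G (G p)) (2 * i) \<noteq> 1" using Suc.prems(1) by (simp add: gauss_code_G)
    then obtain z where z: "z \<in> orb (G (G p))" "letter (G (G p)) z = 1" using Suc.IH GG by blast
    define y where "y = emb (G p) z"
    have y: "y \<in> orb (G p)" "letter (G p) y = 2"
      using orb_letter_2[OF G_in_A[OF Suc.prems(2)] z] by (simp_all add: y_def)
    have yb: "0 \<le> y" "y \<le> 1" using orb_bounds[OF G_in_A[OF Suc.prems(2)] y(1)] by auto
    have "letter p ((T p ^^ 1) (emb p y)) = 1"
      using rk_bounds(1)[OF Suc.prems(2)] y(2)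
      by (intro excursion_letter_1[OF Suc.prems(2) yb]) (auto simp: chi_def)
    then show ?case
      using funpow_T_orb[OF emb_orb[OF Suc.prems(2) y(1)], of 1] by blast
  qed
qed

text \<open>The orbit of 1 accumulates from the left at both discontinuities. One level up, the
  discontinuities are interchanged.\<close>

lemma orb_left_of_discontinuities:
  assumes "p \<in> A" "0 < e"
  shows "(\<exists>z\<in>orb p. letter p z = 1 \<and> 1 - fst p - e < z) \<and>
    (\<exists>z\<in>orb p. letter p z = 2 \<and> 1 - snd p - e < z)"
  using assms
proof (induction p e rule: scale_induct)
  case (base p e)
  have b: "0 < fst p" "0 < snd p" using A_bounds[OF base(1)] by auto
  obtain z where z: "z \<in> orb p" "letter p z = 1" using orb_letter_1[OF base(1)] by blast
  obtain y where y: "y \<in> orb (G p)" "letter (G p) y = 1"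
    using orb_letter_1[OF G_in_A[OF base(1)]] by blast
  note y' = orb_letter_2[OF base(1) y]
  show ?case
    using z y' orb_bounds[OF base(1) z(1)] orb_bounds[OF base(1) y'(1)] b base(2)
    by (intro conjI bexI[of _ z] bexI[of _ "emb p y"]) auto
next
  case (step p e)
  have b: "0 < fst p" using A_bounds[OF step(1)] by auto
  have ee: "fst p * (e / fst p) = e" using b by simp
  from step(3) obtain z y where z: "z \<in> orb (G p)" "letter (G p) z = 1" "1 - fst (G p) - e / fst p < z"
    and y: "y \<in> orb (G p)" "letter (G p) y = 2" "1 - snd (G p) - e / fst p < y" by blast
  have "fst p * (1 - fst (G p) - e / fst p) < fst p * z" using z(3) b by simp
  then have z': "1 - snd p - e < emb p z"
    using ee G_eqs(1)[OF step(1)] by (simp add: emb_def algebra_simps)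
  \<comment> \<open>The last point of the excursion over \<open>y\<close>: its image is
    \<open>emb p (y + snd (G p))\<close>, which is near 1 when \<open>y\<close> is near
    \<open>1 - snd (G p)\<close>, and then \<open>u\<close> is near
    \<open>1 - fst p\<close>.\<close>
  define u where "u = (T p ^^ rk p) (emb p y)"
  have yb: "0 \<le> y" "y \<le> 1" using orb_bounds[OF G_in_A[OF step(1)] y(1)] by auto
  have "letter p u = 1"
    unfolding u_def using rk_bounds(1)[OF step(1)] y(2)
    by (intro excursion_letter_1[OF step(1) yb]) (auto simp: chi_def)
  moreover have "u \<in> orb p" unfolding u_def by (intro funpow_T_orb emb_orb[OF step(1) y(1)])
  moreover have "1 - fst p - e < u"
  proof -
    have len: "length (chi (rk p) (letter (G p) y)) = Suc (rk p)" using y(2) by (simp add: chi_def)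
    have "T p u = emb p (T (G p) y)"
      using return_map(2)[OF step(1) yb refl] unfolding len u_def by simp
    then have "u + fst p = emb p (y + snd (G p))"
      using \<open>letter p u = 1\<close> y(2) by (simp add: T_step step_def)
    moreover have "fst p * (1 - snd (G p) - e / fst p) < fst p * y" using y(3) b by simp
    ultimately show ?thesis using ee by (simp add: emb_def algebra_simps)
  qed
  ultimately show ?case using z' orb_letter_2[OF step(1) z(1,2)] by blast
qed

text \<open>Equality of letters belongs to the claim because it makes the excursions one level down
  run in parallel, at constant distance. For \<open>e \<ge> 1\<close> the main concern is the letter
  and the order, supplied by points left of the discontinuities or by 1.\<close>

lemma orb_approximates_Omega:
  assumes "p \<in> A" "0 < e"
  shows "\<forall>x\<in>Omega p. \<exists>z\<in>orb p. letter p z = letter p x \<and> x \<le> z \<and> z < x + e"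
  using assms
proof (induction p e rule: scale_induct)
  case (base p e)
  have b: "0 < snd p" "snd p < fst p" "fst p < 1" using A_bounds[OF base(1)] by auto
  show ?case
  proof
    fix x assume "x \<in> Omega p"
    then have x: "0 \<le> x" "x < 1" using Omega_bounds[of x p] by auto
    consider "letter p x = 1" | "letter p x = 2" | "letter p x = 3" using letter_cases by blast
    then show "\<exists>z\<in>orb p. letter p z = letter p x \<and> x \<le> z \<and> z < x + e"
    proof cases
      case 1
      then have "0 < 1 - fst p - x" by (auto simp: letter_eq split: if_splits)
      from orb_left_of_discontinuities[OF base(1) this] obtain z
        where z: "z \<in> orb p" "letter p z = 1" "x < z" by auto
      then have "z < 1" using b by (auto simp: letter_eq split: if_splits)
      then show ?thesis using z 1 x base(2) by (intro bexI[of _ z]) auto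
    next
      case 2
      then have "0 < 1 - snd p - x" by (auto simp: letter_eq split: if_splits)
      from orb_left_of_discontinuities[OF base(1) this] obtain z
        where z: "z \<in> orb p" "letter p z = 2" "x < z" by auto
      then have "z < 1" using b by (auto simp: letter_eq split: if_splits)
      then show ?thesis using z 2 x base(2) by (intro bexI[of _ z]) auto
    next
      case 3
      then have "0 < x" using x b by (auto simp: letter_eq split: if_splits)
      then show ?thesis using 3 x base(2) letter_1[OF base(1)] one_in_orb[of p]
        by (intro bexI[of _ 1]) auto
    qed
  qed
next
  case (step p e)
  show ?case
  proof
    fix x assume "x \<in> Omega p"
    then obtain y j where y: "y \<in> Omega (G p)" "j < length (chi (rk p) (letter (G p) y))"
      "x = (T p ^^ j) (emb p y)" by (rule Omega_desubst[OF step(1)])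
    obtain z where z: "z \<in> orb (G p)" "letter (G p) z = letter (G p) y" "y \<le> z" "z < y + e / fst p"
      using step(3) y(1) by blast
    have yb: "0 \<le> y" "y \<le> 1" using Omega_bounds[OF y(1)] by auto
    have zb: "0 \<le> z" "z \<le> 1" using orb_bounds[OF G_in_A[OF step(1)] z(1)] by auto
    define z' where "z' = (T p ^^ j) (emb p z)"
    have eq: "coding p (emb p y) i = coding p (emb p z) i" if "i \<le> j" for i
    proof -
      have "i < length (chi (rk p) (letter (G p) y))" using that y(2) by simp
      then show ?thesis
        using return_map(1)[OF step(1) yb refl, of i] return_map(1)[OF step(1) zb refl, of i]
        by (simp add: z(2))
    qed
    have "z' - x = emb p z - emb p y"
      unfolding z'_def y(3) by (rule funpow_T_diff) (simp add: eq)
    then have d: "z' - x = fst p * (z - y)" by (simp only: emb_diff)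
    have "letter p z' = letter p x" using eq[of j] by (simp add: z'_def y(3) coding_def)
    moreover have "z' \<in> orb p" unfolding z'_def by (intro funpow_T_orb emb_orb[OF step(1) z(1)])
    moreover have "0 \<le> fst p * (z - y)" using A_bounds(4)[OF step(1)] z(3) by simp
    moreover have "fst p * (z - y) < e"
      using A_bounds(4)[OF step(1)] z(4) by (simp add: field_simps)
    ultimately show "\<exists>z\<in>orb p. letter p z = letter p x \<and> x \<le> z \<and> z < x + e"
      using d by (intro bexI[of _ z']) auto
  qed
qed

subsection \<open>Continuity of the itinerary\<close>

lemma letter_right_constant: "\<exists>d>0. \<forall>z. x \<le> z \<longrightarrow> z < x + d \<longrightarrow> letter p z = letter p x"
proof -
  have *: "\<exists>d>0. \<forall>z. x \<le> z \<longrightarrow> z < x + d \<longrightarrow> (c \<le> z) = (c \<le> x)" for c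
    by (rule exI[of _ "if x < c then c - x else 1"]) auto
  obtain d0 where d0: "0 < d0" "\<And>z. x \<le> z \<Longrightarrow> z < x + d0 \<Longrightarrow> (0 \<le> z) = (0 \<le> x)"
    using *[of 0] by blast
  obtain d1 where d1: "0 < d1" "\<And>z. x \<le> z \<Longrightarrow> z < x + d1 \<Longrightarrow> (1 - fst p \<le> z) = (1 - fst p \<le> x)"
    using *[of "1 - fst p"] by blast
  obtain d2 where d2: "0 < d2" "\<And>z. x \<le> z \<Longrightarrow> z < x + d2 \<Longrightarrow> (1 - snd p \<le> z) = (1 - snd p \<le> x)"
    using *[of "1 - snd p"] by blast
  have "letter p z = letter p x" if "x \<le> z" "z < x + min d0 (min d1 d2)" for z
    by (intro letter_cong d0(2) d1(2) d2(2)) (use that in auto)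
  moreover have "0 < min d0 (min d1 d2)" using d0(1) d1(1) d2(1) by simp
  ultimately show ?thesis by blast
qed

lemma coding_right_continuous:
  "\<exists>d>0. \<forall>z. x \<le> z \<longrightarrow> z < x + d \<longrightarrow> (\<forall>i<n. coding p z i = coding p x i)"
proof (induction n arbitrary: x)
  case 0 then show ?case by (intro exI[of _ 1]) auto
next
  case (Suc n)
  obtain d1 where d1: "0 < d1" "\<And>z. x \<le> z \<Longrightarrow> z < x + d1 \<Longrightarrow> letter p z = letter p x"
    using letter_right_constant[of x p] by blast
  obtain d2 where d2: "0 < d2"
    "\<And>z i. T p x \<le> z \<Longrightarrow> z < T p x + d2 \<Longrightarrow> i < n \<Longrightarrow> coding p z i = coding p (T p x) i"
    using Suc.IH[of "T p x"] by blast
  have "coding p z i = coding p x i" if z: "x \<le> z" "z < x + min d1 d2" "i < Suc n" for z i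
  proof (cases i)
    case 0 then show ?thesis using d1(2)[of z] z by (simp add: coding_0)
  next
    case (Suc i')
    have "T p z = T p x + (z - x)" using d1(2)[of z] z by (simp add: T_step)
    then show ?thesis using d2(2)[of "T p z" i'] z Suc by (simp add: coding_Suc)
  qed
  moreover have "0 < min d1 d2" using d1(1) d2(1) by simp
  ultimately show ?case by blast
qed

text \<open>At 0 right continuity suffices, as the closure of \<open>Omega p\<close> has no negative
  points.\<close>

lemma letter_locally_constant_on_closure:
  assumes "p \<in> A" "x \<in> closure (Omega p)" "x \<notin> {1 - fst p, 1 - snd p}"
  shows "\<exists>d>0. \<forall>z\<in>closure (Omega p). dist z x < d \<longrightarrow> letter p z = letter p x"
proof (cases "x = 0")
  case True
  obtain d where d: "0 < d" "\<And>z. x \<le> z \<Longrightarrow> z < x + d \<Longrightarrow> letter p z = letter p x"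
    using letter_right_constant[of x p] by blast
  have "letter p z = letter p x" if "z \<in> closure (Omega p)" "dist z x < d" for z
    using d(2)[of z] closure_Omega_bounds(1)[OF assms(1) that(1)] that(2) True
    by (simp add: dist_real_def)
  then show ?thesis using d(1) by blast
next
  case False
  then have "\<forall>\<^sub>F z in nhds x. letter p z = letter p x"
    using assms(3) by (intro letter_locally_constant) auto
  then show ?thesis unfolding eventually_nhds_metric by blast
qed

lemma coding_continuous:
  assumes "p \<in> A" "x \<in> closure (Omega p)" "\<And>i. (T p ^^ i) x \<notin> {1 - fst p, 1 - snd p}"
  shows "\<exists>d>0. \<forall>z\<in>closure (Omega p). dist z x < d \<longrightarrow> (\<forall>i<n. coding p z i = coding p x i)"
  using assms(2,3)
proof (induction n arbitrary: x)
  case 0 then show ?case by (intro exI[of _ 1]) auto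
next
  case (Suc n)
  obtain d1 where d1: "0 < d1"
    "\<And>z. z \<in> closure (Omega p) \<Longrightarrow> dist z x < d1 \<Longrightarrow> letter p z = letter p x"
    using letter_locally_constant_on_closure[OF assms(1) Suc.prems(1)] Suc.prems(2)[of 0] by auto
  have Tx: "T p x \<in> closure (Omega p)" by (rule T_closure_Omega[OF assms(1) Suc.prems(1)])
  have "(T p ^^ i) (T p x) \<notin> {1 - fst p, 1 - snd p}" for i
    using Suc.prems(2)[of "Suc i"] by (simp add: funpow_swap1)
  from Suc.IH[OF Tx this] obtain d2 where d2: "0 < d2"
    "\<And>z i. z \<in> closure (Omega p) \<Longrightarrow> dist z (T p x) < d2 \<Longrightarrow> i < n \<Longrightarrow>
      coding p z i = coding p (T p x) i"
    by blast
  have "coding p z i = coding p x i"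
    if z: "z \<in> closure (Omega p)" "dist z x < min d1 d2" "i < Suc n" for z i
  proof (cases i)
    case 0 then show ?thesis using d1(2)[of z] z by (simp add: coding_0)
  next
    case (Suc i')
    have "dist (T p z) (T p x) = dist z x" using d1(2)[of z] z by (simp add: T_step)
    then show ?thesis
      using d2(2)[OF T_closure_Omega[OF assms(1) z(1)], of i'] z Suc by (simp add: coding_Suc)
  qed
  moreover have "0 < min d1 d2" using d1(1) d2(1) by simp
  ultimately show ?case by blast
qed

section \<open>Convergence and closure in the product topology\<close>

lemma tendsto_nat_fun:
  fixes f :: "'a \<Rightarrow> nat \<Rightarrow> nat"
  assumes "\<And>n. \<forall>\<^sub>F z in F. f z n = l n"
  shows "(f \<longlongrightarrow> l) F"
proof -
  have "limitin (product_topology (\<lambda>i. euclidean) UNIV) f l F"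
    unfolding limitin_componentwise using assms by (auto intro: tendsto_eventually)
  then show ?thesis by (simp add: euclidean_product_topology)
qed

lemma in_closure_nat_fun:
  fixes S :: "(nat \<Rightarrow> nat) set"
  assumes "\<And>n. \<exists>y\<in>S. \<forall>i<n. y i = x i"
  shows "x \<in> closure S"
proof -
  obtain y where y: "\<And>n. y n \<in> S" "\<And>n i. i < n \<Longrightarrow> y n i = x i" using assms by metis
  have "y \<longlonglongrightarrow> x"
  proof (rule tendsto_nat_fun)
    show "\<forall>\<^sub>F n in sequentially. y n i = x i" for i
      using eventually_gt_at_top[of i] by (rule eventually_mono) (rule y(2))
  qed
  then show ?thesis unfolding closure_sequential using y(1) by blast
qed

lemma continuous_coding:
  assumes "p \<in> A" "x \<in> closure (Omega p)" "\<And>i. (T p ^^ i) x \<notin> {1 - fst p, 1 - snd p}"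
  shows "continuous (at x within closure (Omega p)) (coding p)"
  unfolding continuous_within
proof (rule tendsto_nat_fun)
  fix n
  obtain d where d: "0 < d" "\<And>z i. z \<in> closure (Omega p) \<Longrightarrow> dist z x < d \<Longrightarrow> i < Suc n \<Longrightarrow>
      coding p z i = coding p x i"
    using coding_continuous[OF assms, of "Suc n"] by blast
  show "\<forall>\<^sub>F z in at x within closure (Omega p). coding p z n = coding p x n"
    unfolding eventually_at using d(1) d(2)[of _ n] by blast
qed

section \<open>The exceptional set\<close>

lemma exceptional_iff:
  assumes "p \<in> A"
  shows "x \<in> exceptional p \<longleftrightarrow>
    x \<in> closure (Omega p) \<and> (\<exists>i. (T p ^^ i) x \<in> {1 - fst p, 1 - snd p})"
proof -
  have "Tbar p = T p" using Tbar_eq_T[OF assms] by (rule ext)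
  moreover have "x \<in> exceptional p \<longleftrightarrow>
    x \<in> closure (Omega p) \<and> (\<exists>i. (Tbar p ^^ i) x \<in> {1 - fst p, 1 - snd p})"
    by (cases p) (simp add: exceptional_def)
  ultimately show ?thesis by (simp only:)
qed

lemma countable_exceptional:
  assumes "p \<in> A"
  shows "countable (exceptional p)"
proof -
  have pre: "countable (T p -` C)" if "countable C" for C
  proof -
    have "T p -` C \<subseteq> (\<Union>a\<in>{1,2,3}. (\<lambda>y. y - step p a) ` C)"
    proof
      fix x assume "x \<in> T p -` C"
      then have "x \<in> (\<lambda>y. y - step p (letter p x)) ` C"
        by (intro image_eqI[of _ _ "T p x"]) (simp_all add: T_step)
      then show "x \<in> (\<Union>a\<in>{1,2,3}. (\<lambda>y. y - step p a) ` C)" using letter_cases[of p x] by auto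
    qed
    then show ?thesis by (rule countable_subset) (use that in auto)
  qed
  have "countable ((T p ^^ i) -` {1 - fst p, 1 - snd p})" for i
  proof (induction i)
    case (Suc i)
    then show ?case using pre[OF Suc] by (simp add: vimage_comp funpow_swap1 o_def)
  qed auto
  moreover have "exceptional p \<subseteq> (\<Union>i. (T p ^^ i) -` {1 - fst p, 1 - snd p})"
    unfolding subset_iff exceptional_iff[OF assms] by blast
  ultimately show ?thesis by (meson countable_UN countable_subset countableI_type)
qed

section \<open>The limit word\<close>

lemma subst_append: "subst k (u @ v) = subst k u @ subst k v"
  by (simp add: subst_def)

lemma length_subst: "length w \<le> length (subst k w)"
proof (induction w)
  case (Cons a w)
  have "length (subst k (a # w)) = length (chi k a) + length (subst k w)" by (simp add: subst_def)
  moreover have "length (a # w) = 1 + length w" by simp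
  ultimately show ?case using length_chi_pos[of k a] Cons by linarith
qed (simp add: subst_def)

lemma chain_append: "chain k m (u @ v) = chain k m u @ chain k m v"
  by (induction m arbitrary: u v) (simp_all add: subst_append)

lemma length_chain: "length w \<le> length (chain k m w)"
proof (induction m arbitrary: w)
  case 0 then show ?case by (simp add: length_subst)
next
  case (Suc m)
  show ?case using order_trans[OF length_subst Suc] by simp
qed

text \<open>The word of 3 begins with 3, so the approximating words are prefixes of one another, and
  a digit at least 2 lengthens them.\<close>

lemma chain_Suc_3:
  "chain k (Suc m) [3] = chain k m [3] @ chain k m (replicate (k (Suc m) - 1) 1)"
proof -
  have "subst (k (Suc m)) [3] = [3] @ replicate (k (Suc m) - 1) 1"
    by (simp add: subst_def chi_def)
  then show ?thesis unfolding chain.simps o_apply by (simp only: chain_append)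
qed

lemma eventually_length_chain:
  assumes "\<And>m. \<exists>j\<ge>m. k (Suc j) \<ge> 2"
  shows "\<forall>\<^sub>F i in sequentially. n < length (chain k i [3])"
proof -
  have mono: "length (chain k i [3]) \<le> length (chain k j [3])" if "i \<le> j" for i j
  proof (rule lift_Suc_mono_le[of "\<lambda>i. length (chain k i [3])", OF _ that])
    show "length (chain k i [3]) \<le> length (chain k (Suc i) [3])" for i
      unfolding chain_Suc_3 length_append by (rule le_add1)
  qed
  have "\<exists>i. n < length (chain k i [3])"
  proof (induction n)
    case 0
    show ?case by (intro exI[of _ 0] less_le_trans[OF _ length_chain]) simp
  next
    case (Suc n)
    then obtain i where i: "n < length (chain k i [3])" by blast
    obtain j where j: "i \<le> j" "k (Suc j) \<ge> 2" using assms by blast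
    have "k (Suc j) - 1 \<le> length (chain k j (replicate (k (Suc j) - 1) 1))"
      using length_chain[of "replicate (k (Suc j) - 1) 1" k j] by (simp only: length_replicate)
    then have "Suc n < length (chain k (Suc j) [3])"
      unfolding chain_Suc_3 length_append using i mono[OF j(1)] j(2) by linarith
    then show ?case ..
  qed
  then obtain i where i: "n < length (chain k i [3])" ..
  show ?thesis
    using eventually_ge_at_top[of i] by (rule eventually_mono) (rule less_le_trans[OF i mono])
qed

lemma coding_subst:
  assumes "p \<in> A" "0 \<le> y" "y \<le> 1" "\<And>i. i < length w \<Longrightarrow> coding (G p) y i = w ! i"
    and "i < length (subst (rk p) w)"
  shows "coding p (emb p y) i = subst (rk p) w ! i"
  using assms(2-)
proof (induction w arbitrary: y i)
  case Nil then show ?case by (simp add: subst_def)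
next
  case (Cons a w)
  have a: "letter (G p) y = a" using Cons.prems(3)[of 0] by (simp add: coding_0)
  define c where "c = chi (rk p) a"
  have s: "subst (rk p) (a # w) = c @ subst (rk p) w" by (simp add: subst_def c_def)
  note r = return_map[OF assms(1) Cons.prems(1,2) refl, unfolded a, folded c_def]
  show ?case
  proof (cases "i < length c")
    case True
    then show ?thesis using r(1) s by (simp add: nth_append)
  next
    case False
    have y': "0 \<le> T (G p) y" "T (G p) y \<le> 1"
      using T_bounds[OF G_in_A[OF assms(1)] Cons.prems(1,2)] by auto
    have "coding (G p) (T (G p) y) i = w ! i" if "i < length w" for i
      using Cons.prems(3)[of "Suc i"] that by (simp add: coding_Suc)
    moreover have "i - length c < length (subst (rk p) w)" using Cons.prems(4) False s by simp
    ultimately have "coding p (emb p (T (G p) y)) (i - length c) = subst (rk p) w ! (i - length c)"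
      using Cons.IH[OF y'] by blast
    moreover have "coding p (emb p y) i = coding p (emb p (T (G p) y)) (i - length c)"
      using coding_funpow[of p "length c" "emb p y" "i - length c"] False r(2) by simp
    ultimately show ?thesis using False s by (simp add: nth_append)
  qed
qed

text \<open>\<open>chain k m\<close> composes the \<open>m + 1\<close> substitutions with digits at
  0 to \<open>m\<close>, so \<open>w\<close> is read at level \<open>Suc m\<close>. As
  \<open>emb\<close> fixes 1, the base point is the same at every level.\<close>

lemma coding_chain:
  assumes "p \<in> A" "\<And>i. i < length w \<Longrightarrow> coding ((G ^^ Suc m) p) 1 i = w ! i"
    and "i < length (chain (gauss_code p) m w)"
  shows "coding p 1 i = chain (gauss_code p) m w ! i"
  using assms(2-)
proof (induction m arbitrary: w i)
  case 0
  then show ?case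
    using coding_subst[OF assms(1), of 1 w i] by (simp add: gauss_code_0[OF assms(1)] emb_1)
next
  case (Suc m)
  define q where "q = (G ^^ Suc m) p"
  have q: "q \<in> A" unfolding q_def by (rule funpow_G_in_A[OF assms(1)])
  have rk: "gauss_code p (Suc m) = rk q" unfolding q_def by (rule gauss_code_rk[OF assms(1)])
  have "coding q 1 i = subst (rk q) w ! i" if "i < length (subst (rk q) w)" for i
  proof -
    have "coding (G q) 1 i = w ! i" if "i < length w" for i
      using Suc.prems(1)[OF that] by (simp add: q_def)
    then show ?thesis using coding_subst[OF q _ _ _ that, of 1] by (simp add: emb_1)
  qed
  then show ?case
    using Suc.IH[of "subst (rk q) w" i] Suc.prems(2) unfolding q_def[symmetric]
    by (simp add: rk)
qed

text \<open>At every level the itinerary of 1 begins with 3, so \<open>coding_chain\<close> applies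
  to \<open>[3]\<close>; the lengths are unbounded since digits other than 1 keep occurring.\<close>

lemma limit_word_eq_coding:
  assumes "p \<in> A"
  shows "limit_word (\<lambda>i. chain (gauss_code p) i [3]) = coding p 1"
proof
  fix n
  define w where "w i = chain (gauss_code p) i [3]" for i
  have "\<exists>j\<ge>m. gauss_code p (Suc j) \<ge> 2" for m
  proof -
    obtain i where "gauss_code ((G ^^ Suc m) p) i \<noteq> 1"
      using ex_code_neq_1[OF funpow_G_in_A[OF assms]] by blast
    then have "gauss_code p (Suc (m + i)) \<noteq> 1" by (simp only: gauss_code_funpow_G) simp
    moreover have "1 \<le> gauss_code p (Suc (m + i))"
      using gauss_code_in_K[OF assms] by (simp add: K_def)
    ultimately show ?thesis by (intro exI[of _ "m + i"]) auto
  qed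
  then have len: "\<forall>\<^sub>F i in sequentially. n < length (w i)"
    unfolding w_def by (rule eventually_length_chain)
  have val: "w i ! n = coding p 1 n" if "n < length (w i)" for i
  proof -
    have "letter ((G ^^ Suc i) p) 1 = 3" by (rule letter_1[OF funpow_G_in_A[OF assms]])
    then have "coding ((G ^^ Suc i) p) 1 j = [3] ! j" if "j < length [3]" for j
      using that by (simp add: coding_0 del: funpow.simps)
    from coding_chain[OF assms this] show ?thesis using that unfolding w_def by simp
  qed
  have "(THE a. \<forall>\<^sub>F i in sequentially. n < length (w i) \<and> w i ! n = a) = coding p 1 n"
  proof (rule the_equality)
    show "\<forall>\<^sub>F i in sequentially. n < length (w i) \<and> w i ! n = coding p 1 n"
      using len by (rule eventually_mono) (simp add: val)
    fix a assume "\<forall>\<^sub>F i in sequentially. n < length (w i) \<and> w i ! n = a"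
    then obtain i where "n < length (w i)" "w i ! n = a"
      using eventually_happens'[OF sequentially_bot] by blast
    then show "a = coding p 1 n" using val by simp
  qed
  then show "limit_word (\<lambda>i. chain (gauss_code p) i [3]) n = coding p 1 n"
    by (simp add: limit_word_def w_def)
qed

section \<open>The subshift as an orbit closure, and the coding map\<close>

lemma funpow_shift_coding: "(shift ^^ i) (coding p x) = coding p ((T p ^^ i) x)"
proof (induction i)
  case (Suc i)
  have "shift (coding p y) = coding p (T p y)" for y by (simp add: shift_def coding_Suc)
  then show ?case using Suc by simp
qed simp

lemma Sigma_shift_eq:
  assumes "p \<in> A"
  shows "Sigma_shift (gauss_code p) = closure (coding p ` orb p)"
proof -
  have "{(shift ^^ i) (coding p 1) | i. True} = coding p ` orb p"
    by (auto simp: funpow_shift_coding orb_def)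
  then show ?thesis by (simp add: Sigma_shift_def limit_word_eq_coding[OF assms])
qed

lemma coding_isomorphism_Tbar:
  assumes "p \<in> A"
  shows "coding_isomorphism (Tbar p) (closure (Omega p)) (exceptional p) (itinerary p)
    (Sigma_shift (gauss_code p))"
proof -
  have Tb: "Tbar p = T p" using Tbar_eq_T[OF assms] by (rule ext)
  have it: "itinerary p = coding p" using itinerary_eq_coding[OF assms] by (rule ext)
  have orb: "orb p \<subseteq> closure (Omega p)"
    unfolding orb_def
    by (intro image_subsetI funpow_T_closure_Omega[OF assms one_in_closure_Omega[OF assms]])
  \<comment> \<open>Outside the orbit of 1 the point lies in \<open>Omega p\<close> and is
    approximated by that orbit from the right, the side on which itineraries are continuous.\<close>
  have sub: "coding p x \<in> closure (coding p ` orb p)" if "x \<in> closure (Omega p)" for x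
  proof (cases "x \<in> orb p")
    case True
    then show ?thesis using closure_subset[of "coding p ` orb p"] by auto
  next
    case False
    then have x: "x \<in> Omega p" using closure_Omega[OF assms] that by blast
    show ?thesis
    proof (rule in_closure_nat_fun)
      fix n
      obtain d where d: "0 < d"
        "\<And>z i. x \<le> z \<Longrightarrow> z < x + d \<Longrightarrow> i < n \<Longrightarrow> coding p z i = coding p x i"
        using coding_right_continuous[of x n p] by blast
      obtain z where "z \<in> orb p" "x \<le> z" "z < x + d"
        using bspec[OF orb_approximates_Omega[OF assms d(1)] x] by blast
      then show "\<exists>y\<in>coding p ` orb p. \<forall>i<n. y i = coding p x i"
        by (intro bexI[of _ "coding p z"]) (auto intro: d(2))
    qed
  qed
  have invariant: "T p ` closure (Omega p) \<subseteq> closure (Omega p)"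
    by (rule image_subsetI) (rule T_closure_Omega[OF assms])
  have into: "coding p ` closure (Omega p) \<subseteq> closure (coding p ` orb p)"
    by (rule image_subsetI) (rule sub)
  \<comment> \<open>The orbit of 1 lies in the closure of \<open>Omega p\<close> because 1
    does.\<close>
  have dense: "closure (coding p ` orb p) \<subseteq> closure (coding p ` closure (Omega p))"
    by (rule closure_mono, rule image_mono, rule orb)
  have "coding p (T p x) = shift (coding p x)" for x
    by (rule ext) (simp add: shift_def coding_Suc)
  then have intertwines: "\<forall>x\<in>closure (Omega p). coding p (T p x) = shift (coding p x)" by blast
  have continuous: "\<forall>x\<in>closure (Omega p) - exceptional p.
      continuous (at x within closure (Omega p)) (coding p)"
  proof
    fix x assume x: "x \<in> closure (Omega p) - exceptional p"
    then have "(T p ^^ i) x \<notin> {1 - fst p, 1 - snd p}" for i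
      using exceptional_iff[OF assms, of x] by blast
    moreover have "x \<in> closure (Omega p)" using x by simp
    ultimately show "continuous (at x within closure (Omega p)) (coding p)"
      by (intro continuous_coding[OF assms])
  qed
  have "y = x" if x: "x \<in> closure (Omega p)" and y: "y \<in> closure (Omega p)"
    and eq: "coding p y = coding p x" for x y
    by (rule coding_inj[OF assms closure_Omega_bounds[OF assms y] closure_Omega_bounds[OF assms x] eq])
  then have injective: "\<forall>x\<in>closure (Omega p) - exceptional p. \<forall>y\<in>closure (Omega p).
      coding p y = coding p x \<longrightarrow> y = x"
    by blast
  show ?thesis
    unfolding coding_isomorphism_def Tb it Sigma_shift_eq[OF assms]
    by (intro conjI invariant into dense intertwines continuous injective
        countable_exceptional[OF assms])
qed

theorem theorem7:
  "uncountable A \<and>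
   bij_betw gauss_code A K \<and>
   (\<forall>k\<in>K. \<forall>p\<in>A. gauss_code p = k \<longrightarrow>
      coding_isomorphism (Tbar p) (closure (Omega p)) (exceptional p) (itinerary p) (Sigma_shift k))"
  by (auto simp: uncountable_A bij_betw_gauss_code intro: coding_isomorphism_Tbar)

end
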